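(* Let $k\ge1$ be a fixed integer and let $\mathbf P$ be an irreducible $s\times s$ stochastic matrix. The map $\Phi_k:\mathbb R^{s\times s}\to\mathbb R^{s\times s}$, $\Phi_k(\mathbf M)=\mathbf M^k$, is Fréchet differentiable and its derivative at $\mathbf P$ is $$\Phi'_{k,\mathbf P}(\mathbf H)=\sum_{i=0}^{k-1}\mathbf P^i\mathbf H\mathbf P^{k-1-i}.$$ Consequently, with $\widehat{\mathbf P}(n)$ the maximum likelihood estimator of $\mathbf P$ and $\mathbf W$, $\mathbf W_{\mathbf p}$, $\mathbf\Sigma_{\mathbf p}$ as in the context, $$\sqrt n\{\widehat{\mathbf P}(n)^k-\mathbf P^k\}\xrightarrow{d}\mathbf W_{\mathbf P^k}:=\sum_{i=0}^{k-1}\mathbf P^i\mathbf W\mathbf P^{k-1-i}.$$ If $\mathbf M_k=\sum_{i=0}^{k-1}\mathbf P^i\otimes(\mathbf P^{k-1-i})^\top$, then $$\operatorname{vec}(\mathbf W_{\mathbf P^k}^\top)=\mathbf M_k\mathbf W_{\mathbf p}\sim\mathcal N_{s^2}(\mathbf 0_{s^2},\ \mathbf M_k\mathbf\Sigma_{\mathbf p}\mathbf M_k^\top).$$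
   Context: $(X_m)_{m\ge0}$ is a time-homogeneous Markov chain on $\{1,\ldots,s\}$ with irreducible transition matrix $\mathbf P=(p_{ij})$ and stationary row vector $\boldsymbol\pi=(\pi_1,\ldots,\pi_s)$, observed along a single trajectory $X_0,\ldots,X_n$. $N_{ij}(n)$ is the number of transitions from $i$ to $j$ up to time $n$, $N_i(n)=\sum_jN_{ij}(n)$, and $\widehat{\mathbf P}(n)$ has entries $N_{ij}(n)/N_i(n)$ (and $0$ if $N_i(n)=0$). Limits are as $n\to\infty$; $\xrightarrow{d}$ is convergence in distribution. $\mathbf W=(W_{ij})$ is the centered Gaussian random $s\times s$ matrix with $\operatorname{Cov}(W_{ij},W_{kl})=\delta_{ik}\pi_i^{-1}p_{ij}(\delta_{jl}-p_{il})$. $\operatorname{vec}$ stacks columns, $\mathbf W_{\mathbf p}=\operatorname{vec}(\mathbf W^\top)$, and $\mathbf\Sigma_{\mathbf p}=\operatorname{Cov}(\mathbf W_{\mathbf p})$, i.e. the block diagonal matrix with blocks $\pi_i^{-1}\mathbf\Lambda_i$, $\mathbf\Lambda_i(j,k)=p_{ij}(\delta_{jk}-p_{ik})$. $\otimes$ is the Kronecker product. *)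

theory Defs
  imports "HOL-Probability.Probability"
begin

section \<open>Matrices\<close>

text \<open>
  The class operation \<open>(*)\<close>, and hence \<open>(^)\<close>, on \<^typ>\<open>real^'n^'n\<close> is the entrywise one; powers of
  square matrices with respect to the matrix product \<open>(**)\<close> need their own definition.
\<close>

primrec matpow :: "real^'n^'n \<Rightarrow> nat \<Rightarrow> real^'n^'n" where
  "matpow A 0 = mat 1"
| "matpow A (Suc m) = A ** matpow A m"

text \<open>
  Vectors with \<open>s\<^sup>2\<close> entries are indexed by pairs, ordered lexicographically: the pair \<open>(j, i)\<close> of
  1-based indices stands for the position \<open>(j - 1) s + i\<close>. Stacking columns therefore places the
  entry in row \<open>i\<close> and column \<open>j\<close> at the index \<open>(j, i)\<close>.
\<close>

definition vec_cols :: "real^'n^'m \<Rightarrow> real^('n \<times> 'm)" where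
  "vec_cols A = (\<chi> q. A $ snd q $ fst q)"

definition kronecker :: "real^'n^'m \<Rightarrow> real^'q^'p \<Rightarrow> real^('n \<times> 'q)^('m \<times> 'p)" where
  "kronecker A B = (\<chi> a b. A $ fst a $ fst b * B $ snd a $ snd b)"

definition kdelta :: "'n \<Rightarrow> 'n \<Rightarrow> real" where
  "kdelta i j = (if i = j then 1 else 0)"


section \<open>Finite Markov chains\<close>

definition stochastic_matrix :: "real^'s^'s \<Rightarrow> bool" where
  "stochastic_matrix P \<longleftrightarrow> (\<forall>i j. 0 \<le> P $ i $ j) \<and> (\<forall>i. (\<Sum>j\<in>UNIV. P $ i $ j) = 1)"

definition irreducible_matrix :: "real^'s^'s \<Rightarrow> bool" where
  "irreducible_matrix P \<longleftrightarrow> (\<forall>i j. \<exists>m. 0 < matpow P m $ i $ j)"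

definition stationary_distribution :: "real^'s^'s \<Rightarrow> real^'s \<Rightarrow> bool" where
  "stationary_distribution P \<pi> \<longleftrightarrow>
     (\<forall>i. 0 \<le> \<pi> $ i) \<and> (\<Sum>i\<in>UNIV. \<pi> $ i) = 1 \<and> \<pi> v* P = \<pi>"

text \<open>The initial distribution is arbitrary.\<close>

definition markov_chain :: "'a measure \<Rightarrow> (nat \<Rightarrow> 'a \<Rightarrow> 's::finite) \<Rightarrow> real^'s^'s \<Rightarrow> bool" where
  "markov_chain M X P \<longleftrightarrow>
     prob_space M \<and> stochastic_matrix P \<and>
     (\<forall>m. X m \<in> M \<rightarrow>\<^sub>M count_space UNIV) \<and>
     (\<forall>m x. \<P>(\<omega> in M. \<forall>l\<le>m. X l \<omega> = x l) > 0 \<longrightarrow>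
        cond_prob M (\<lambda>\<omega>. X (Suc m) \<omega> = x (Suc m)) (\<lambda>\<omega>. \<forall>l\<le>m. X l \<omega> = x l)
          = P $ x m $ x (Suc m))"

definition transition_count :: "(nat \<Rightarrow> 's) \<Rightarrow> nat \<Rightarrow> 's \<Rightarrow> 's \<Rightarrow> nat" where
  "transition_count x n i j = card {m. m < n \<and> x m = i \<and> x (Suc m) = j}"

definition visit_count :: "(nat \<Rightarrow> 's::finite) \<Rightarrow> nat \<Rightarrow> 's \<Rightarrow> nat" where
  "visit_count x n i = (\<Sum>j\<in>UNIV. transition_count x n i j)"

definition P_hat :: "(nat \<Rightarrow> 's::finite) \<Rightarrow> nat \<Rightarrow> real^'s^'s" where
  "P_hat x n = (\<chi> i j. if visit_count x n i = 0 then 0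
     else real (transition_count x n i j) / real (visit_count x n i))"


section \<open>Gaussian random elements and convergence in distribution\<close>

text \<open>The univariate normal law with mean \<open>\<mu>\<close> and variance \<open>v \<ge> 0\<close>, a point mass if \<open>v = 0\<close>.\<close>

definition normal_law :: "real \<Rightarrow> real \<Rightarrow> real measure" where
  "normal_law \<mu> v =
     (if v = 0 then return borel \<mu> else density lborel (\<lambda>x. ennreal (normal_density \<mu> (sqrt v) x)))"

text \<open>
  Singular covariances are allowed. The definition applies to vectors \<^typ>\<open>real^'n\<close> and to matrices
  \<^typ>\<open>real^'n^'m\<close> alike, the inner product of matrices being the sum of the entrywise products.
\<close>

definition gaussian :: "'b measure \<Rightarrow> ('b \<Rightarrow> 'v::euclidean_space) \<Rightarrow> bool" where
  "gaussian N Y \<longleftrightarrow>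
     prob_space N \<and> Y \<in> borel_measurable N \<and>
     (\<forall>a. \<exists>\<mu> v. 0 \<le> v \<and> distr N borel (\<lambda>\<omega>. a \<bullet> Y \<omega>) = normal_law \<mu> v)"

definition covariance :: "'b measure \<Rightarrow> ('b \<Rightarrow> real) \<Rightarrow> ('b \<Rightarrow> real) \<Rightarrow> real" where
  "covariance N U V =
     integral\<^sup>L N (\<lambda>\<omega>. (U \<omega> - integral\<^sup>L N U) * (V \<omega> - integral\<^sup>L N V))"

definition covariance_matrix :: "'b measure \<Rightarrow> ('b \<Rightarrow> real^'n) \<Rightarrow> real^'n^'n" where
  "covariance_matrix N Y = (\<chi> i j. covariance N (\<lambda>\<omega>. Y \<omega> $ i) (\<lambda>\<omega>. Y \<omega> $ j))"

definition multivariate_normal ::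
    "'b measure \<Rightarrow> ('b \<Rightarrow> real^'n) \<Rightarrow> real^'n \<Rightarrow> real^'n^'n \<Rightarrow> bool" where
  "multivariate_normal N Y \<mu> \<Sigma> \<longleftrightarrow>
     gaussian N Y \<and> integral\<^sup>L N Y = \<mu> \<and> covariance_matrix N Y = \<Sigma>"

definition converges_in_distribution ::
    "'a measure \<Rightarrow> (nat \<Rightarrow> 'a \<Rightarrow> 'v::metric_space) \<Rightarrow> 'b measure \<Rightarrow> ('b \<Rightarrow> 'v) \<Rightarrow> bool" where
  "converges_in_distribution M Y N Z \<longleftrightarrow>
     (\<forall>n. Y n \<in> borel_measurable M) \<and> Z \<in> borel_measurable N \<and>
     (\<forall>f :: 'v \<Rightarrow> real. continuous_on UNIV f \<and> bounded (range f) \<longrightarrow>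
        (\<lambda>n. integral\<^sup>L M (\<lambda>\<omega>. f (Y n \<omega>))) \<longlonglongrightarrow> integral\<^sup>L N (\<lambda>\<omega>. f (Z \<omega>)))"


section \<open>The limiting Gaussian matrix\<close>

definition limit_gaussian_matrix ::
    "'b measure \<Rightarrow> ('b \<Rightarrow> real^'s^'s) \<Rightarrow> real^'s^'s \<Rightarrow> real^'s \<Rightarrow> bool" where
  "limit_gaussian_matrix N W P \<pi> \<longleftrightarrow>
     gaussian N W \<and> integral\<^sup>L N W = 0 \<and>
     (\<forall>i j k l. covariance N (\<lambda>\<omega>. W \<omega> $ i $ j) (\<lambda>\<omega>. W \<omega> $ k $ l)
        = kdelta i k * inverse (\<pi> $ i) * P $ i $ j * (kdelta j l - P $ i $ l))"

definition Lambda :: "real^'s^'s \<Rightarrow> 's \<Rightarrow> real^'s^'s" where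
  "Lambda P i = (\<chi> j k. P $ i $ j * (kdelta j k - P $ i $ k))"

definition Sigma_p :: "real^'s^'s \<Rightarrow> real^'s \<Rightarrow> real^('s \<times> 's)^('s \<times> 's)" where
  "Sigma_p P \<pi> = (\<chi> a b. if fst a = fst b
     then inverse (\<pi> $ fst a) * Lambda P (fst a) $ snd a $ snd b else 0)"

definition M_mat :: "real^'s^'s \<Rightarrow> nat \<Rightarrow> real^('s \<times> 's)^('s \<times> 's)" where
  "M_mat P k = (\<Sum>i<k. kronecker (matpow P i) (transpose (matpow P (k - 1 - i))))"

end

theory Submission
  imports Defs "HOL-Real_Asymp.Real_Asymp"
begin

text \<open>
  The derivative of \<open>\<lambda>B. matpow B k\<close> comes from the product rule by induction on \<open>k\<close>
  (\<open>matpow_has_derivative\<close>), and the Gaussian law of the stacked limit is that of a linear image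
  (\<open>multivariate_normal_linear_image\<close>, \<open>vec_cols_transpose_matpow_derivative\<close>). The substance is the
  central limit theorem for the estimator, which the delta method carries over to its \<open>k\<close>-th power.

  The innovation \<open>N\<^sub>i\<^sub>j - N\<^sub>i p\<^sub>i\<^sub>j\<close> is a martingale with bounded increments, so its entries have size
  \<open>sqrt n\<close>. Summing over \<open>i\<close> shows that the visit frequencies are invariant under \<open>P\<close> up to an error of order
  \<open>1 / sqrt n\<close>; since irreducibility makes the invariant vector of given mass unique, linear algebra
  already yields the law of large numbers \<open>N\<^sub>i / n \<rightarrow> \<pi>\<^sub>i\<close> (\<open>visit_frequency_lln\<close>). Hence
  \<open>sqrt n (P_hat - P)\<close> agrees with the innovation divided by \<open>sqrt n \<pi>\<^sub>i\<close> in row \<open>i\<close>, up to a term that vanishes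
  in probability (\<open>estimator_expansion\<close>).

  A linear functional of the innovation is a sum of centred functions of consecutive states. Its
  characteristic function at the frequency \<open>1 / sqrt n\<close>, multiplied by the exponential of half the
  accumulated conditional variance, changes by only \<open>o (1 / n)\<close> per step by the Markov property, and
  so tends to \<open>1\<close>. By the law of large numbers the accumulated variance tends to a constant, which
  turns this into the limit of the characteristic function itself (\<open>additive_functional_clt\<close>).

  Characteristic functions determine convergence in distribution through the continuity theorem in
  several dimensions (\<open>converges_in_distribution_of_char\<close>). Boundedness in probability being known
  from second moments, the theorem reduces to approximating a bounded continuous function on a ball by a
  globally bounded trigonometric polynomial (\<open>trig_poly_approximation\<close>).
\<close>

section \<open>Derivatives of matrix powers\<close>

lemma bounded_bilinear_matrix_mult:
  "bounded_bilinear (\<lambda>(A :: real^'n::finite^'m::finite) (B :: real^'p::finite^'n). A ** B)"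
  by (rule bilinear_conv_bounded_bilinear[THEN iffD1])
     (auto simp: bilinear_def matrix_matrix_mult_def vec_eq_iff sum.distrib sum_distrib_left
        algebra_simps intro!: linearI)

text \<open>
  The product rule applied to \<open>A ** matpow A k\<close>: differentiating the first factor gives the term
  \<open>H ** matpow A k\<close>, which becomes the summand \<open>i = 0\<close>, and multiplying the derivative of
  \<open>matpow A k\<close> by \<open>A\<close> from the left shifts every other summand by one.
\<close>

lemma matpow_has_derivative:
  fixes A :: "real^'s::finite^'s"
  shows "((\<lambda>B. matpow B k) has_derivative
           (\<lambda>H. \<Sum>i<k. matpow A i ** H ** matpow A (k - 1 - i))) (at A)"
proof (induction k)
  case 0
  then show ?case by simp
next
  case (Suc k)
  have "((\<lambda>B. B ** matpow B k) has_derivative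
      (\<lambda>H. A ** (\<Sum>i<k. matpow A i ** H ** matpow A (k - 1 - i)) + H ** matpow A k)) (at A)"
    by (rule bounded_bilinear.FDERIV[OF bounded_bilinear_matrix_mult has_derivative_ident Suc])
  moreover have "A ** (\<Sum>i<k. matpow A i ** H ** matpow A (k - 1 - i)) + H ** matpow A k
      = (\<Sum>i<Suc k. matpow A i ** H ** matpow A (Suc k - 1 - i))" for H
    by (simp add: sum.lessThan_Suc_shift bounded_bilinear.sum_right[OF bounded_bilinear_matrix_mult]
        matrix_mul_assoc add.commute del: sum.lessThan_Suc)
  ultimately show ?case by simp
qed

section \<open>Boundedness and convergence in probability\<close>

definition bounded_in_prob :: "'a measure \<Rightarrow> (nat \<Rightarrow> 'a \<Rightarrow> 'v::real_normed_vector) \<Rightarrow> bool" where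
  "bounded_in_prob M Y \<longleftrightarrow>
     (\<forall>e>0. \<exists>K. \<forall>\<^sub>F n in sequentially. measure M {\<omega>\<in>space M. K < norm (Y n \<omega>)} < e)"

definition vanishes_in_prob :: "'a measure \<Rightarrow> (nat \<Rightarrow> 'a \<Rightarrow> 'v::real_normed_vector) \<Rightarrow> bool" where
  "vanishes_in_prob M Y \<longleftrightarrow>
     (\<forall>d>0. \<forall>e>0. \<forall>\<^sub>F n in sequentially. measure M {\<omega>\<in>space M. d < norm (Y n \<omega>)} < e)"

lemma vanishes_in_probD:
  assumes "vanishes_in_prob M Y" "d > 0" "e > 0"
  shows "\<forall>\<^sub>F n in sequentially. measure M {\<omega>\<in>space M. d < norm (Y n \<omega>)} < e"
  using assms unfolding vanishes_in_prob_def by blast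

context prob_space
begin

lemma measure_le_of_subset_Un:
  assumes "A \<in> events" "B \<in> events" "C \<subseteq> A \<union> B"
  shows "prob C \<le> prob A + prob B"
proof -
  have "prob C \<le> prob (A \<union> B)"
    using assms by (intro finite_measure_mono) auto
  also have "\<dots> \<le> prob A + prob B"
    using assms by (intro measure_Un_le) auto
  finally show ?thesis .
qed

lemma bounded_in_prob_const: "bounded_in_prob M (\<lambda>n \<omega>. c)"
  unfolding bounded_in_prob_def by (auto intro!: exI[of _ "norm c"])

lemma vanishes_in_prob_deterministic:
  assumes "a \<longlonglongrightarrow> 0"
  shows "vanishes_in_prob M (\<lambda>n \<omega>. a n)"
  unfolding vanishes_in_prob_def
proof (intro allI impI)
  fix d e :: real assume de: "d > 0" "e > 0"
  then have "\<forall>\<^sub>F n in sequentially. norm (a n) < d"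
    using assms by (metis tendsto_norm_zero order_tendstoD(2))
  then show "\<forall>\<^sub>F n in sequentially. prob {\<omega>\<in>space M. d < norm (a n)} < e"
    by eventually_elim (use de in auto)
qed

lemma vanishes_in_prob_add:
  fixes Y Z :: "nat \<Rightarrow> 'a \<Rightarrow> 'v::euclidean_space"
  assumes [measurable]: "\<And>n. Y n \<in> borel_measurable M" "\<And>n. Z n \<in> borel_measurable M"
    and "vanishes_in_prob M Y" "vanishes_in_prob M Z"
  shows "vanishes_in_prob M (\<lambda>n \<omega>. Y n \<omega> + Z n \<omega>)"
  unfolding vanishes_in_prob_def
proof (intro allI impI)
  fix d e :: real assume de: "d > 0" "e > 0"
  have "\<forall>\<^sub>F n in sequentially. prob {\<omega>\<in>space M. d/2 < norm (Y n \<omega>)} < e/2"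
    "\<forall>\<^sub>F n in sequentially. prob {\<omega>\<in>space M. d/2 < norm (Z n \<omega>)} < e/2"
    using de by (intro vanishes_in_probD assms(3,4); simp)+
  then show "\<forall>\<^sub>F n in sequentially. prob {\<omega>\<in>space M. d < norm (Y n \<omega> + Z n \<omega>)} < e"
  proof eventually_elim
    case (elim n)
    have "{\<omega>\<in>space M. d < norm (Y n \<omega> + Z n \<omega>)}
        \<subseteq> {\<omega>\<in>space M. d/2 < norm (Y n \<omega>)} \<union> {\<omega>\<in>space M. d/2 < norm (Z n \<omega>)}"
    proof (intro subsetI, rule ccontr)
      fix \<omega> assume "\<omega> \<in> {\<omega>\<in>space M. d < norm (Y n \<omega> + Z n \<omega>)}"
        "\<omega> \<notin> {\<omega>\<in>space M. d/2 < norm (Y n \<omega>)} \<union> {\<omega>\<in>space M. d/2 < norm (Z n \<omega>)}"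
      then show False using norm_triangle_ineq[of "Y n \<omega>" "Z n \<omega>"] by simp
    qed
    from measure_le_of_subset_Un[OF _ _ this] elim show ?case by simp
  qed
qed

lemma bounded_in_prob_add:
  fixes Y Z :: "nat \<Rightarrow> 'a \<Rightarrow> 'v::euclidean_space"
  assumes [measurable]: "\<And>n. Y n \<in> borel_measurable M" "\<And>n. Z n \<in> borel_measurable M"
    and "bounded_in_prob M Y" "bounded_in_prob M Z"
  shows "bounded_in_prob M (\<lambda>n \<omega>. Y n \<omega> + Z n \<omega>)"
  unfolding bounded_in_prob_def
proof (intro allI impI)
  fix e :: real assume e: "e > 0"
  obtain K L where
    "\<forall>\<^sub>F n in sequentially. prob {\<omega>\<in>space M. K < norm (Y n \<omega>)} < e/2"
    "\<forall>\<^sub>F n in sequentially. prob {\<omega>\<in>space M. L < norm (Z n \<omega>)} < e/2"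
    using assms(3,4) e unfolding bounded_in_prob_def by (meson half_gt_zero)
  then have "\<forall>\<^sub>F n in sequentially. prob {\<omega>\<in>space M. K + L < norm (Y n \<omega> + Z n \<omega>)} < e"
  proof eventually_elim
    case (elim n)
    have "{\<omega>\<in>space M. K + L < norm (Y n \<omega> + Z n \<omega>)}
        \<subseteq> {\<omega>\<in>space M. K < norm (Y n \<omega>)} \<union> {\<omega>\<in>space M. L < norm (Z n \<omega>)}"
    proof (intro subsetI, rule ccontr)
      fix \<omega> assume "\<omega> \<in> {\<omega>\<in>space M. K + L < norm (Y n \<omega> + Z n \<omega>)}"
        "\<omega> \<notin> {\<omega>\<in>space M. K < norm (Y n \<omega>)} \<union> {\<omega>\<in>space M. L < norm (Z n \<omega>)}"
      then show False using norm_triangle_ineq[of "Y n \<omega>" "Z n \<omega>"] by simp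
    qed
    from measure_le_of_subset_Un[OF _ _ this] elim show ?case by simp
  qed
  then show "\<exists>K. \<forall>\<^sub>F n in sequentially. prob {\<omega>\<in>space M. K < norm (Y n \<omega> + Z n \<omega>)} < e" ..
qed

lemma vanishes_imp_bounded_in_prob:
  assumes "vanishes_in_prob M Y"
  shows "bounded_in_prob M Y"
  using assms unfolding vanishes_in_prob_def bounded_in_prob_def by (meson zero_less_one)

lemma bounded_in_prob_mono:
  assumes [measurable]: "\<And>n. Y n \<in> borel_measurable M"
    and "bounded_in_prob M Y" "C > 0" "\<And>n \<omega>. \<omega> \<in> space M \<Longrightarrow> norm (Z n \<omega>) \<le> C * norm (Y n \<omega>)"
  shows "bounded_in_prob M Z"
  unfolding bounded_in_prob_def
proof (intro allI impI)
  fix e :: real assume e: "e > 0"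
  obtain K where
    "\<forall>\<^sub>F n in sequentially. prob {\<omega>\<in>space M. K < norm (Y n \<omega>)} < e"
    using assms(2) e unfolding bounded_in_prob_def by meson
  then have "\<forall>\<^sub>F n in sequentially. prob {\<omega>\<in>space M. C * K < norm (Z n \<omega>)} < e"
  proof eventually_elim
    case (elim n)
    have "{\<omega>\<in>space M. C * K < norm (Z n \<omega>)} \<subseteq> {\<omega>\<in>space M. K < norm (Y n \<omega>)}"
    proof
      fix \<omega> assume "\<omega> \<in> {\<omega>\<in>space M. C * K < norm (Z n \<omega>)}"
      then have "\<omega> \<in> space M" "C * K < C * norm (Y n \<omega>)" using assms(4)[of \<omega> n] by auto
      then show "\<omega> \<in> {\<omega>\<in>space M. K < norm (Y n \<omega>)}" using assms(3) by simp
    qed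
    from finite_measure_mono[OF this] elim show ?case
      by simp
  qed
  then show "\<exists>K. \<forall>\<^sub>F n in sequentially. prob {\<omega>\<in>space M. K < norm (Z n \<omega>)} < e" ..
qed

text \<open>
  The rule by which every remainder below is shown to vanish: if \<open>Y\<close> stays bounded and the ratio of \<open>R\<close>
  to \<open>Y\<close> can be made arbitrarily small by making \<open>A\<close> small, then \<open>R\<close> vanishes with \<open>A\<close>. Products of a
  vanishing and a bounded sequence, continuous images of vanishing sequences and remainders of
  differentiable functions are all of this kind, for suitable \<open>A\<close> and \<open>Y\<close>.
\<close>

lemma vanishes_in_prob_small_multiple:
  fixes A :: "nat \<Rightarrow> 'a \<Rightarrow> 'u::real_normed_vector" and Y :: "nat \<Rightarrow> 'a \<Rightarrow> 'v::real_normed_vector"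
    and R :: "nat \<Rightarrow> 'a \<Rightarrow> 'w::real_normed_vector"
  assumes [measurable]: "\<And>n. A n \<in> borel_measurable M" "\<And>n. Y n \<in> borel_measurable M"
    and A: "vanishes_in_prob M A" and Y: "bounded_in_prob M Y"
    and R: "\<And>\<eta>. \<eta> > 0 \<Longrightarrow> \<exists>\<delta>>0. \<forall>\<^sub>F n in sequentially. \<forall>\<omega>\<in>space M.
              norm (A n \<omega>) \<le> \<delta> \<longrightarrow> norm (R n \<omega>) \<le> \<eta> * norm (Y n \<omega>)"
  shows "vanishes_in_prob M R"
  unfolding vanishes_in_prob_def
proof (intro allI impI)
  fix d e :: real assume de: "d > 0" "e > 0"
  then obtain K0 where K0: "\<forall>\<^sub>F n in sequentially. prob {\<omega>\<in>space M. K0 < norm (Y n \<omega>)} < e/2"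
    using Y unfolding bounded_in_prob_def by (meson half_gt_zero)
  define K where "K = max K0 1"
  have K: "K0 \<le> K" "K > 0" unfolding K_def by auto
  obtain \<delta> where \<delta>: "\<delta> > 0" and ev: "\<forall>\<^sub>F n in sequentially. \<forall>\<omega>\<in>space M.
      norm (A n \<omega>) \<le> \<delta> \<longrightarrow> norm (R n \<omega>) \<le> d / K * norm (Y n \<omega>)"
    using R[of "d / K"] de K by auto
  have "\<forall>\<^sub>F n in sequentially. prob {\<omega>\<in>space M. \<delta> < norm (A n \<omega>)} < e/2"
    using de by (intro vanishes_in_probD A \<delta>) simp
  with K0 ev show "\<forall>\<^sub>F n in sequentially. prob {\<omega>\<in>space M. d < norm (R n \<omega>)} < e"
  proof eventually_elim
    case (elim n)
    have "{\<omega>\<in>space M. d < norm (R n \<omega>)}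
        \<subseteq> {\<omega>\<in>space M. \<delta> < norm (A n \<omega>)} \<union> {\<omega>\<in>space M. K0 < norm (Y n \<omega>)}"
    proof (intro subsetI, rule ccontr)
      fix \<omega> assume \<omega>: "\<omega> \<in> {\<omega>\<in>space M. d < norm (R n \<omega>)}"
        "\<omega> \<notin> {\<omega>\<in>space M. \<delta> < norm (A n \<omega>)} \<union> {\<omega>\<in>space M. K0 < norm (Y n \<omega>)}"
      then have "norm (R n \<omega>) \<le> d / K * norm (Y n \<omega>)" using elim by auto
      also have "\<dots> \<le> d / K * K" using \<omega> K de by (intro mult_left_mono) auto
      finally show False using \<omega> K by auto
    qed
    from measure_le_of_subset_Un[OF _ _ this] elim show ?case by simp
  qed
qed

text \<open>
  Chebyshev's inequality.
\<close>

lemma bounded_second_moment_imp_bounded_in_prob: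
  fixes Y :: "nat \<Rightarrow> 'a \<Rightarrow> real"
  assumes [measurable]: "\<And>n. Y n \<in> borel_measurable M"
    and int: "\<And>n. integrable M (\<lambda>\<omega>. (Y n \<omega>)\<^sup>2)" and C: "\<And>n. expectation (\<lambda>\<omega>. (Y n \<omega>)\<^sup>2) \<le> C"
  shows "bounded_in_prob M Y"
  unfolding bounded_in_prob_def
proof (intro allI impI)
  fix e :: real assume e: "e > 0"
  have C0: "C \<ge> 0" using C[of 0] by (smt (verit) integral_nonneg_AE AE_I2 zero_le_power2)
  \<comment> \<open>With this \<open>K\<close> the bound \<open>C / K\<^sup>2\<close> is strictly below \<open>e\<close>, also when \<open>C = 0\<close>.\<close>
  define K where "K = sqrt ((C + 1) / e)"
  have K2: "K\<^sup>2 = (C + 1) / e" and K0: "K > 0" unfolding K_def using C0 e by auto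
  have "prob {\<omega>\<in>space M. K < norm (Y n \<omega>)} < e" for n
  proof -
    have "{\<omega>\<in>space M. K < norm (Y n \<omega>)} \<subseteq> {\<omega>\<in>space M. K\<^sup>2 \<le> (Y n \<omega>)\<^sup>2}"
      using K0 by (auto simp: abs_le_square_iff[symmetric])
    then have "prob {\<omega>\<in>space M. K < norm (Y n \<omega>)} \<le> prob {\<omega>\<in>space M. K\<^sup>2 \<le> (Y n \<omega>)\<^sup>2}"
      by (intro finite_measure_mono) auto
    also have "\<dots> \<le> expectation (\<lambda>\<omega>. (Y n \<omega>)\<^sup>2) / K\<^sup>2"
      using K0 int by (intro integral_Markov_inequality_measure[where A = "{}"]) auto
    also have "\<dots> \<le> C / K\<^sup>2" using C by (intro divide_right_mono) auto
    also have "\<dots> < e" unfolding K2 using C0 e by (simp add: field_simps)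
    finally show ?thesis .
  qed
  then show "\<exists>K. \<forall>\<^sub>F n in sequentially. prob {\<omega>\<in>space M. K < norm (Y n \<omega>)} < e"
    by (intro exI[of _ K] always_eventually) blast
qed

text \<open>
  The integrand is split along the exceptional event \<open>A\<close>, off which it is small. The special case
  \<open>A = {}\<close> bounds the norm of an expectation by a bound of the integrand.
\<close>

lemma integral_norm_le_of_prob:
  fixes R :: "'a \<Rightarrow> 'v::{banach, second_countable_topology}"
  assumes [measurable]: "R \<in> borel_measurable M" "A \<in> events"
    and B: "\<And>\<omega>. \<omega> \<in> space M \<Longrightarrow> norm (R \<omega>) \<le> B" "B \<ge> 0"
    and d: "\<And>\<omega>. \<omega> \<in> space M - A \<Longrightarrow> norm (R \<omega>) \<le> d" "d \<ge> 0"
  shows "norm (expectation R) \<le> d + B * prob A"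
proof -
  have int: "integrable M (indicat_real A)"
    by (rule integrable_real_indicator) (auto simp: less_top[symmetric])
  have "norm (expectation R) \<le> expectation (\<lambda>\<omega>. norm (R \<omega>))"
    by (rule integral_norm_bound)
  also have "\<dots> \<le> expectation (\<lambda>\<omega>. d + B * indicator A \<omega>)"
  proof (rule integral_mono)
    show "integrable M (\<lambda>\<omega>. norm (R \<omega>))"
      using B by (intro integrable_const_bound[of _ B]) auto
    show "norm (R \<omega>) \<le> d + B * indicator A \<omega>" if "\<omega> \<in> space M" for \<omega>
      using that B d by (cases "\<omega> \<in> A") (fastforce simp: add_increasing)+
    show "integrable M (\<lambda>\<omega>. d + B * indicator A \<omega>)" using int by simp
  qed
  also have "\<dots> = d + B * prob A"
    using int by (simp add: prob_space)
  finally show ?thesis .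
qed

lemma bounded_convergence_in_prob:
  fixes R :: "nat \<Rightarrow> 'a \<Rightarrow> 'v::euclidean_space"
  assumes [measurable]: "\<And>n. R n \<in> borel_measurable M"
    and B: "\<And>n \<omega>. \<omega> \<in> space M \<Longrightarrow> norm (R n \<omega>) \<le> B" and R: "vanishes_in_prob M R"
  shows "(\<lambda>n. expectation (R n)) \<longlonglongrightarrow> 0"
proof (rule tendstoI)
  fix e :: real assume e: "e > 0"
  obtain \<omega>0 where "\<omega>0 \<in> space M" using not_empty by auto
  then have B0: "B \<ge> 0" using B order_trans[OF norm_ge_zero] by blast
  have "\<forall>\<^sub>F n in sequentially. prob {\<omega>\<in>space M. e/2 < norm (R n \<omega>)} < e / (2 * (B + 1))"
    using e B0 by (intro vanishes_in_probD R) auto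
  then show "\<forall>\<^sub>F n in sequentially. dist (expectation (R n)) 0 < e"
  proof eventually_elim
    case (elim n)
    have "norm (expectation (R n)) \<le> e/2 + B * prob {\<omega>\<in>space M. e/2 < norm (R n \<omega>)}"
      using B e B0 by (intro integral_norm_le_of_prob) auto
    also have "B * prob {\<omega>\<in>space M. e/2 < norm (R n \<omega>)}
        \<le> (B + 1) * prob {\<omega>\<in>space M. e/2 < norm (R n \<omega>)}"
      by (intro mult_right_mono) auto
    also have "\<dots> < (B + 1) * (e / (2 * (B + 1)))"
      using elim B0 by (intro mult_strict_left_mono) auto
    also have "\<dots> = e/2" using B0 by (simp add: field_simps)
    finally show ?case by simp
  qed
qed

lemma tight_single:
  fixes Z :: "'a \<Rightarrow> 'v::euclidean_space"
  assumes [measurable]: "Z \<in> borel_measurable M" and e: "e > 0"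
  shows "\<exists>K. prob {\<omega>\<in>space M. K < norm (Z \<omega>)} < e"
proof -
  define A where "A n = {\<omega>\<in>space M. real n < norm (Z \<omega>)}" for n :: nat
  have "(\<lambda>n. prob (A n)) \<longlonglongrightarrow> prob (\<Inter>n. A n)"
    unfolding A_def by (intro finite_Lim_measure_decseq) (auto simp: decseq_def)
  also have "(\<Inter>n. A n) = {}"
    unfolding A_def by (auto) (meson less_asym reals_Archimedean2)
  finally have "\<forall>\<^sub>F n in sequentially. prob (A n) < e"
    using e by (auto dest: order_tendstoD)
  then show ?thesis unfolding A_def eventually_sequentially by blast
qed

end

section \<open>Characteristic functions and convergence in distribution\<close>

text \<open>
  Trigonometric polynomials on a Euclidean space, generated by the characters so that any property
  that is linear in the function needs to be checked for characters only.
\<close>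

inductive trig_poly :: "('v::euclidean_space \<Rightarrow> complex) \<Rightarrow> bool" where
  iexp: "trig_poly (\<lambda>x. iexp (\<theta> \<bullet> x))"
| scale: "trig_poly f \<Longrightarrow> trig_poly (\<lambda>x. c * f x)"
| add: "trig_poly f \<Longrightarrow> trig_poly g \<Longrightarrow> trig_poly (\<lambda>x. f x + g x)"

lemma trig_poly_mult:
  assumes "trig_poly f" "trig_poly g"
  shows "trig_poly (\<lambda>x. f x * g x)"
  using assms
proof (induction f)
  case (iexp \<theta>)
  from iexp.prems show ?case
  proof (induction g)
    case (iexp \<theta>')
    show ?case
      using trig_poly.iexp[of "\<theta> + \<theta>'"]
      by (simp add: inner_add_left exp_add[symmetric] distrib_left)
  next
    case (scale g c)
    from trig_poly.scale[OF scale.IH, of c] show ?case by (simp add: algebra_simps)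
  next
    case (add g h)
    from trig_poly.add[OF add.IH] show ?case by (simp add: algebra_simps)
  qed
next
  case (scale f c)
  from trig_poly.scale[OF scale.IH[OF scale.prems], of c] show ?case
    by (simp add: algebra_simps)
next
  case (add f h)
  from trig_poly.add[OF add.IH(1)[OF add.prems] add.IH(2)[OF add.prems]] show ?case
    by (simp add: algebra_simps)
qed

lemma trig_poly_const: "trig_poly (\<lambda>x. c)"
  using trig_poly.scale[OF trig_poly.iexp[of 0], of c] by simp

lemma trig_poly_sum:
  assumes "finite I" "\<And>i. i \<in> I \<Longrightarrow> trig_poly (f i)"
  shows "trig_poly (\<lambda>x. \<Sum>i\<in>I. f i x)"
  using assms by (induction I) (auto intro: trig_poly_const trig_poly.add)

lemma trig_poly_sin: "trig_poly (\<lambda>x. complex_of_real (sin (\<theta> \<bullet> x)))"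
proof -
  have "trig_poly (\<lambda>x. - \<i> / 2 * iexp (\<theta> \<bullet> x) + \<i> / 2 * iexp ((-\<theta>) \<bullet> x))"
    by (intro trig_poly.intros)
  moreover have "- \<i> / 2 * iexp t + \<i> / 2 * iexp (- t) = complex_of_real (sin t)" for t
    by (simp add: complex_eq_iff Re_exp Im_exp)
  ultimately show ?thesis by simp
qed

text \<open>
  A polynomial in the sines of the rescaled coordinates is a trigonometric polynomial, because
  trigonometric polynomials form an algebra. This is how an approximating polynomial becomes
  accessible to characteristic functions.
\<close>

lemma trig_poly_real_polynomial_sin:
  fixes p :: "'v::euclidean_space \<Rightarrow> real"
  assumes "real_polynomial_function p"
  shows "trig_poly (\<lambda>x. complex_of_real (p (\<Sum>b\<in>Basis. sin (x \<bullet> b / L) *\<^sub>R b)))"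
  using assms
proof (induction p)
  case (linear f)
  have "trig_poly (\<lambda>x. \<Sum>b\<in>Basis. complex_of_real (f b) * complex_of_real (sin ((b /\<^sub>R L) \<bullet> x)))"
    by (intro trig_poly_sum trig_poly.scale trig_poly_sin) auto
  moreover have "complex_of_real (f (\<Sum>b\<in>Basis. sin (x \<bullet> b / L) *\<^sub>R b))
      = (\<Sum>b\<in>Basis. complex_of_real (f b) * complex_of_real (sin ((b /\<^sub>R L) \<bullet> x)))" for x
    using linear
    by (simp add: linear_sum bounded_linear.linear linear_scale inner_commute divide_inverse mult.commute)
  ultimately show ?case by simp
next
  case (const c)
  show ?case by (rule trig_poly_const)
next
  case (add f g)
  from trig_poly.add[OF add.IH] show ?case by simp
next
  case (mult f g)
  from trig_poly_mult[OF mult.IH] show ?case by simp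
qed

lemma trig_poly_bounded_continuous:
  assumes "trig_poly f"
  shows "continuous_on UNIV f" "\<exists>B. \<forall>x. norm (f x) \<le> B"
proof -
  show "continuous_on UNIV f"
    using assms by induction (auto intro!: continuous_intros)
  show "\<exists>B. \<forall>x. norm (f x) \<le> B"
    using assms
  proof induction
    case (iexp \<theta>)
    show ?case by (intro exI[of _ 1]) simp
  next
    case (scale f c)
    then obtain B where "\<forall>x. norm (f x) \<le> B" by blast
    then show ?case
      by (intro exI[of _ "norm c * B"]) (auto simp: norm_mult intro: mult_left_mono)
  next
    case (add f g)
    then obtain B C where "\<forall>x. norm (f x) \<le> B" "\<forall>x. norm (g x) \<le> C" by blast
    then show ?case
      by (intro exI[of _ "B + C"]) (auto intro: norm_triangle_mono)
  qed
qed

lemma (in prob_space) trig_poly_integrable: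
  assumes "trig_poly f" and [measurable]: "Y \<in> borel_measurable M"
  shows "integrable M (\<lambda>\<omega>. f (Y \<omega>))"
proof -
  have [measurable]: "f \<in> borel_measurable borel"
    using trig_poly_bounded_continuous(1)[OF assms(1)] by (rule borel_measurable_continuous_onI)
  obtain B where "\<forall>x. norm (f x) \<le> B"
    using trig_poly_bounded_continuous(2)[OF assms(1)] by blast
  then show ?thesis by (intro integrable_const_bound[of _ B]) auto
qed

lemma trig_poly_tendsto_expectation:
  fixes Z :: "'b \<Rightarrow> 'v::euclidean_space"
  assumes "prob_space M" "prob_space N"
    and Y: "\<And>n. Y n \<in> borel_measurable M" and Z: "Z \<in> borel_measurable N"
    and cf: "\<And>\<theta>. (\<lambda>n. integral\<^sup>L M (\<lambda>\<omega>. iexp (\<theta> \<bullet> Y n \<omega>)))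
               \<longlonglongrightarrow> integral\<^sup>L N (\<lambda>\<omega>. iexp (\<theta> \<bullet> Z \<omega>))"
    and "trig_poly f"
  shows "(\<lambda>n. integral\<^sup>L M (\<lambda>\<omega>. f (Y n \<omega>))) \<longlonglongrightarrow> integral\<^sup>L N (\<lambda>\<omega>. f (Z \<omega>))"
  using assms(6)
proof induction
  case (iexp \<theta>)
  show ?case by (rule cf)
next
  case (scale f c)
  from tendsto_mult_left[OF scale.IH] show ?case by simp
next
  case (add f g)
  from tendsto_add[OF add.IH] show ?case
    using add.hyps assms(1,2) Y Z by (simp add: prob_space.trig_poly_integrable)
qed

text \<open>
  On a ball of radius \<open>L\<close> the rescaled coordinates lie in \<open>[-1, 1]\<close>, inside the interval on which
  \<open>arcsin\<close> inverts \<open>sin\<close>. So on this ball the point is a continuous function of the sines of its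
  rescaled coordinates.
\<close>

lemma arcsin_sin_coordinatewise:
  fixes x :: "'v::euclidean_space"
  assumes "norm x \<le> L" "L > 0"
  shows "(\<Sum>b\<in>Basis. (L * arcsin (sin (x \<bullet> b / L))) *\<^sub>R b) = x"
proof -
  have "L * arcsin (sin (x \<bullet> b / L)) = x \<bullet> b" if "b \<in> Basis" for b
  proof -
    have "\<bar>x \<bullet> b\<bar> \<le> L" using Basis_le_norm[OF that, of x] assms by linarith
    then have "\<bar>x \<bullet> b / L\<bar> \<le> 1" using assms by simp
    then have "arcsin (sin (x \<bullet> b / L)) = x \<bullet> b / L"
      using pi_gt3 by (intro arcsin_sin) linarith+
    then show ?thesis using assms by simp
  qed
  then show ?thesis by (simp add: euclidean_representation)
qed

text \<open>
  Approximation on a ball by a trigonometric polynomial that is bounded globally. Near the origin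
  \<open>f x\<close> equals \<open>G (u x)\<close>, where \<open>u x\<close> has the coordinates \<open>sin (x \<bullet> b / L)\<close> and \<open>G\<close> undoes the sines by
  \<open>arcsin\<close>. By Stone-Weierstrass, \<open>G\<close> is uniformly close to a polynomial \<open>p\<close> on the cube \<open>[-1, 1]\<^sup>d\<close>. Since
  \<open>u x\<close> lies in this cube for every \<open>x\<close>, the function \<open>p (u x)\<close> inherits the bound of \<open>f\<close> everywhere,
  which a polynomial in the coordinates themselves would not do.
\<close>

lemma trig_poly_approximation:
  fixes f :: "'v::euclidean_space \<Rightarrow> real"
  assumes f: "continuous_on UNIV f" and B: "\<And>x. \<bar>f x\<bar> \<le> B" and L: "L > 0" and d: "d > 0"
  obtains h :: "'v \<Rightarrow> real" where "trig_poly (\<lambda>x. complex_of_real (h x))"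
    "\<And>x. norm x \<le> L \<Longrightarrow> \<bar>f x - h x\<bar> \<le> d" "\<And>x. \<bar>h x\<bar> \<le> B + d"
proof -
  define G where "G u = f (\<Sum>b\<in>Basis. (L * arcsin (u \<bullet> b)) *\<^sub>R b)" for u :: 'v
  define u where "u x = (\<Sum>b\<in>Basis. sin (x \<bullet> b / L) *\<^sub>R b)" for x :: 'v
  have ub: "u x \<bullet> b = sin (x \<bullet> b / L)" if "b \<in> Basis" for x b
    using that unfolding u_def by simp
  have u_mem: "u x \<in> cbox (- One) One" for x
    by (auto simp: mem_box ub)
  have "continuous_on (cbox (- One) One) (\<lambda>u::'v. \<Sum>b\<in>Basis. (L * arcsin (u \<bullet> b)) *\<^sub>R b)"
    by (intro continuous_intros) (auto simp: mem_box)
  then have "continuous_on (cbox (- One) One) G"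
    unfolding G_def using continuous_on_compose2[OF f] by blast
  then obtain p where p: "real_polynomial_function p"
    "\<And>v. v \<in> cbox (- One) One \<Longrightarrow> \<bar>G v - p v\<bar> < d"
    using Stone_Weierstrass_real_polynomial_function[OF compact_cbox _ d] by blast
  show thesis
  proof (rule that[of "\<lambda>x. p (u x)"])
    show "trig_poly (\<lambda>x. complex_of_real (p (u x)))"
      unfolding u_def by (rule trig_poly_real_polynomial_sin[OF p(1)])
    show "\<bar>f x - p (u x)\<bar> \<le> d" if "norm x \<le> L" for x
    proof -
      have "G (u x) = f x"
        unfolding G_def using arcsin_sin_coordinatewise[OF that L] by (simp add: ub)
      then show ?thesis using p(2)[OF u_mem[of x]] by simp
    qed
    show "\<bar>p (u x)\<bar> \<le> B + d" for x
      using p(2)[OF u_mem[of x]] B[of "(\<Sum>b\<in>Basis. (L * arcsin (u x \<bullet> b)) *\<^sub>R b)"]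
      unfolding G_def by linarith
  qed
qed

text \<open>
  The continuity theorem in several dimensions for sequences that are bounded in probability. Such a
  sequence spends little mass outside a large ball, and there both the test function and its
  approximating trigonometric polynomial are bounded; inside, they differ by little. So it suffices
  that the expectations of trigonometric polynomials converge.
\<close>

theorem converges_in_distribution_of_char:
  fixes Z :: "'b \<Rightarrow> 'v::euclidean_space"
  assumes M: "prob_space M" and N: "prob_space N"
    and Y[measurable]: "\<And>n. Y n \<in> borel_measurable M" and Z[measurable]: "Z \<in> borel_measurable N"
    and tight: "bounded_in_prob M Y"
    and cf: "\<And>\<theta>. (\<lambda>n. integral\<^sup>L M (\<lambda>\<omega>. iexp (\<theta> \<bullet> Y n \<omega>)))
               \<longlonglongrightarrow> integral\<^sup>L N (\<lambda>\<omega>. iexp (\<theta> \<bullet> Z \<omega>))"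
  shows "converges_in_distribution M Y N Z"
  unfolding converges_in_distribution_def
proof (intro conjI allI impI)
  interpret M: prob_space M by fact
  interpret N: prob_space N by fact
  fix f :: "'v \<Rightarrow> real"
  assume "continuous_on UNIV f \<and> bounded (range f)"
  then obtain B where f: "continuous_on UNIV f" and B: "\<And>x. \<bar>f x\<bar> \<le> B"
    unfolding bounded_iff by auto
  have B0: "B \<ge> 0" using B[of undefined] by linarith
  have [measurable]: "f \<in> borel_measurable borel"
    using f by (rule borel_measurable_continuous_onI)
  show "(\<lambda>n. integral\<^sup>L M (\<lambda>\<omega>. f (Y n \<omega>))) \<longlonglongrightarrow> integral\<^sup>L N (\<lambda>\<omega>. f (Z \<omega>))"
  proof (rule tendstoI)
    fix e :: real assume e: "e > 0"
    \<comment> \<open>Each truncation costs less than \<open>2 d\<close> and the trigonometric polynomial costs \<open>d\<close>. The choice of \<open>r\<close>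
      makes the mass outside the ball, times the bound \<open>2 B + d\<close> of the error there, smaller than \<open>d\<close>.\<close>
    define d where "d = e / 6"
    define r where "r = d / (2 * B + 2 * d)"
    have d: "d > 0" and r: "r > 0" unfolding d_def r_def using e B0 by (auto intro!: divide_pos_pos add_nonneg_pos)
    obtain K1 where K1: "\<forall>\<^sub>F n in sequentially. measure M {\<omega>\<in>space M. K1 < norm (Y n \<omega>)} < r"
      using tight r unfolding bounded_in_prob_def by blast
    obtain K2 where K2: "measure N {\<omega>\<in>space N. K2 < norm (Z \<omega>)} < r"
      using N.tight_single[OF Z r] by blast
    define L where "L = max 1 (max K1 K2)"
    have L: "L > 0" "K1 \<le> L" "K2 \<le> L" unfolding L_def by auto
    obtain h :: "'v \<Rightarrow> real" where h: "trig_poly (\<lambda>x. complex_of_real (h x))"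
      "\<And>x. norm x \<le> L \<Longrightarrow> \<bar>f x - h x\<bar> \<le> d" "\<And>x. \<bar>h x\<bar> \<le> B + d"
      using trig_poly_approximation[OF f B L(1) d] by blast
    have h_meas[measurable]: "h \<in> borel_measurable borel"
      using measurable_compose[OF borel_measurable_continuous_onI[OF
          trig_poly_bounded_continuous(1)[OF h(1)]] borel_measurable_Re] by simp
    have diff: "\<bar>integral\<^sup>L Q (\<lambda>\<omega>. f (V \<omega>)) - integral\<^sup>L Q (\<lambda>\<omega>. h (V \<omega>))\<bar> < 2 * d"
      if Q: "prob_space Q" and V[measurable]: "V \<in> borel_measurable Q"
        and K: "measure Q {\<omega>\<in>space Q. K < norm (V \<omega>)} < r" and KL: "K \<le> L" for Q :: "'c measure" and V K
    proof -
      interpret Q: prob_space Q by fact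
      have i: "integrable Q (\<lambda>\<omega>. f (V \<omega>))" "integrable Q (\<lambda>\<omega>. h (V \<omega>))"
        using B h(3) by (auto intro: Q.integrable_const_bound[of _ B] Q.integrable_const_bound[of _ "B + d"])
      have "norm (integral\<^sup>L Q (\<lambda>\<omega>. f (V \<omega>) - h (V \<omega>)))
          \<le> d + (2 * B + d) * measure Q {\<omega>\<in>space Q. K < norm (V \<omega>)}"
      proof (rule Q.integral_norm_le_of_prob)
        show "norm (f (V \<omega>) - h (V \<omega>)) \<le> 2 * B + d" for \<omega>
          using B[of "V \<omega>"] h(3)[of "V \<omega>"] by simp
        show "norm (f (V \<omega>) - h (V \<omega>)) \<le> d"
          if "\<omega> \<in> space Q - {\<omega>\<in>space Q. K < norm (V \<omega>)}" for \<omega>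
          using that h(2)[of "V \<omega>"] KL by auto
      qed (use B0 d in auto)
      also have "\<dots> \<le> d + (2 * B + d) * r"
        using K B0 d by (intro add_left_mono mult_left_mono) auto
      also have "(2 * B + d) * r < (2 * B + 2 * d) * r"
        using r d by (intro mult_strict_right_mono) auto
      also have "(2 * B + 2 * d) * r = d" unfolding r_def using B0 d by simp
      finally show ?thesis using i by simp
    qed
    have "(\<lambda>n. complex_of_real (integral\<^sup>L M (\<lambda>\<omega>. h (Y n \<omega>)))) \<longlonglongrightarrow> complex_of_real (integral\<^sup>L N (\<lambda>\<omega>. h (Z \<omega>)))"
      using trig_poly_tendsto_expectation[OF M N Y Z cf h(1)] by simp
    then have "(\<lambda>n. integral\<^sup>L M (\<lambda>\<omega>. h (Y n \<omega>))) \<longlonglongrightarrow> integral\<^sup>L N (\<lambda>\<omega>. h (Z \<omega>))"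
      by (rule tendsto_of_real_iff[THEN iffD1])
    then have "\<forall>\<^sub>F n in sequentially. dist (integral\<^sup>L M (\<lambda>\<omega>. h (Y n \<omega>))) (integral\<^sup>L N (\<lambda>\<omega>. h (Z \<omega>))) < d"
      using d by (rule tendstoD)
    with K1 show "\<forall>\<^sub>F n in sequentially.
        dist (integral\<^sup>L M (\<lambda>\<omega>. f (Y n \<omega>))) (integral\<^sup>L N (\<lambda>\<omega>. f (Z \<omega>))) < e"
    proof eventually_elim
      case (elim n)
      show ?case
        using diff[OF M Y elim(1) L(2)] diff[OF N Z K2 L(3)] elim(2) unfolding d_def dist_real_def by linarith
    qed
  qed
qed (use Y Z in auto)

text \<open>
  Slutsky's theorem, combined with the continuity theorem: a vanishing perturbation changes neither the
  limits of the characteristic functions, as \<open>iexp\<close> is Lipschitz and bounded, nor boundedness in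
  probability.
\<close>

theorem converges_in_distribution_of_char_perturbed:
  fixes Z :: "'b \<Rightarrow> 'v::euclidean_space"
  assumes M: "prob_space M" and N: "prob_space N"
    and Y[measurable]: "\<And>n. Y n \<in> borel_measurable M" and Y'[measurable]: "\<And>n. Y' n \<in> borel_measurable M"
    and Z: "Z \<in> borel_measurable N"
    and tight: "bounded_in_prob M Y"
    and cf: "\<And>\<theta>. (\<lambda>n. integral\<^sup>L M (\<lambda>\<omega>. iexp (\<theta> \<bullet> Y n \<omega>)))
               \<longlonglongrightarrow> integral\<^sup>L N (\<lambda>\<omega>. iexp (\<theta> \<bullet> Z \<omega>))"
    and R: "vanishes_in_prob M (\<lambda>n \<omega>. Y' n \<omega> - Y n \<omega>)"
  shows "converges_in_distribution M Y' N Z"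
proof (rule converges_in_distribution_of_char[OF M N Y' Z])
  interpret M: prob_space M by fact
  have "bounded_in_prob M (\<lambda>n \<omega>. Y n \<omega> + (Y' n \<omega> - Y n \<omega>))"
    by (intro M.bounded_in_prob_add tight M.vanishes_imp_bounded_in_prob R) measurable
  then show "bounded_in_prob M Y'" by simp
  fix \<theta> :: 'v
  have "vanishes_in_prob M (\<lambda>n \<omega>. iexp (\<theta> \<bullet> Y' n \<omega>) - iexp (\<theta> \<bullet> Y n \<omega>))"
  proof (rule M.vanishes_in_prob_small_multiple[where A = "\<lambda>n \<omega>. Y' n \<omega> - Y n \<omega>" and Y = "\<lambda>n \<omega>. 1::real"])
    fix \<eta> :: real assume \<eta>: "\<eta> > 0"
    show "\<exists>\<delta>>0. \<forall>\<^sub>F n in sequentially. \<forall>\<omega>\<in>space M. norm (Y' n \<omega> - Y n \<omega>) \<le> \<delta> \<longrightarrow>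
        norm (iexp (\<theta> \<bullet> Y' n \<omega>) - iexp (\<theta> \<bullet> Y n \<omega>)) \<le> \<eta> * norm (1::real)"
    proof (intro exI[of _ "\<eta> / (norm \<theta> + 1)"] conjI always_eventually allI ballI impI)
      show "0 < \<eta> / (norm \<theta> + 1)" using \<eta> by (simp add: add_nonneg_pos)
      fix n \<omega> assume le: "norm (Y' n \<omega> - Y n \<omega>) \<le> \<eta> / (norm \<theta> + 1)"
      have "norm (iexp a - iexp b) \<le> \<bar>a - b\<bar>" for a b
      proof -
        have "iexp a - iexp b = iexp b * (iexp (a - b) - 1)"
          by (simp add: right_diff_distrib exp_add[symmetric])
        then show ?thesis using iexp_approx1[of "a - b" 0] by (simp add: norm_mult)
      qed
      then have "norm (iexp (\<theta> \<bullet> Y' n \<omega>) - iexp (\<theta> \<bullet> Y n \<omega>)) \<le> \<bar>\<theta> \<bullet> (Y' n \<omega> - Y n \<omega>)\<bar>"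
        by (simp add: inner_diff_right)
      also have "\<dots> \<le> norm \<theta> * norm (Y' n \<omega> - Y n \<omega>)" by (rule Cauchy_Schwarz_ineq2)
      also have "\<dots> \<le> (norm \<theta> + 1) * (\<eta> / (norm \<theta> + 1))"
        using le \<eta> by (intro mult_mono) auto
      also have "\<dots> = \<eta>" by (simp add: add_nonneg_eq_0_iff)
      finally show "norm (iexp (\<theta> \<bullet> Y' n \<omega>) - iexp (\<theta> \<bullet> Y n \<omega>)) \<le> \<eta> * norm (1::real)" by simp
    qed
  qed (use R M.bounded_in_prob_const in auto)
  then have "(\<lambda>n. M.expectation (\<lambda>\<omega>. iexp (\<theta> \<bullet> Y' n \<omega>) - iexp (\<theta> \<bullet> Y n \<omega>))) \<longlonglongrightarrow> 0"
    by (rule M.bounded_convergence_in_prob[rotated 2, where B = 2])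
       (auto intro: norm_triangle_ineq4[THEN order_trans])
  moreover have "integrable M (\<lambda>\<omega>. iexp (\<theta> \<bullet> Y' n \<omega>))" "integrable M (\<lambda>\<omega>. iexp (\<theta> \<bullet> Y n \<omega>))" for n
    by (auto intro!: M.integrable_const_bound[of _ 1])
  ultimately have "(\<lambda>n. M.expectation (\<lambda>\<omega>. iexp (\<theta> \<bullet> Y' n \<omega>)) - M.expectation (\<lambda>\<omega>. iexp (\<theta> \<bullet> Y n \<omega>))) \<longlonglongrightarrow> 0"
    by simp
  from tendsto_add[OF this cf[of \<theta>]]
  show "(\<lambda>n. M.expectation (\<lambda>\<omega>. iexp (\<theta> \<bullet> Y' n \<omega>))) \<longlonglongrightarrow> integral\<^sup>L N (\<lambda>\<omega>. iexp (\<theta> \<bullet> Z \<omega>))"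
    by simp
qed

section \<open>Expectations along a Markov chain\<close>

text \<open>
  A functional of the whole trajectory that factors through the times \<open>0, \<dots>, m\<close>. The states being
  finitely many, such functionals are finite sums over paths, which settles measurability and
  integrability at once.
\<close>

definition depends_on_past :: "nat \<Rightarrow> ((nat \<Rightarrow> 's) \<Rightarrow> 'b) \<Rightarrow> bool" where
  "depends_on_past m F \<longleftrightarrow> (\<forall>x y. (\<forall>l\<le>m. x l = y l) \<longrightarrow> F x = F y)"

locale finite_markov_chain =
  fixes M :: "'a measure" and X :: "nat \<Rightarrow> 'a \<Rightarrow> 's::finite" and P :: "real^'s^'s"
  assumes markov: "markov_chain M X P"
begin

sublocale prob_space M
  using markov unfolding markov_chain_def by blast

lemma X_measurable[measurable]: "X m \<in> M \<rightarrow>\<^sub>M count_space UNIV"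
  using markov unfolding markov_chain_def by blast

lemma P_nonneg: "0 \<le> P $ i $ j" and P_sum: "(\<Sum>j\<in>UNIV. P $ i $ j) = 1"
  using markov unfolding markov_chain_def stochastic_matrix_def by blast+

definition path_event :: "nat \<Rightarrow> (nat \<Rightarrow> 's) \<Rightarrow> 'a set" where
  "path_event m x = {\<omega>\<in>space M. \<forall>l\<le>m. X l \<omega> = x l}"

abbreviation trajectory :: "'a \<Rightarrow> nat \<Rightarrow> 's" where
  "trajectory \<omega> \<equiv> (\<lambda>l. X l \<omega>)"

lemma path_event_measurable[measurable]: "path_event m x \<in> events"
  unfolding path_event_def by measurable

text \<open>
  For paths of positive probability this is the defining property of a Markov chain; for the others
  both sides are zero.
\<close>

lemma prob_path_event_Suc:
  "prob (path_event (Suc m) (x(Suc m := j))) = prob (path_event m x) * P $ x m $ j"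
proof -
  let ?x = "x(Suc m := j)"
  have eq: "path_event m ?x = path_event m x"
    unfolding path_event_def by auto
  have sub: "path_event (Suc m) ?x \<subseteq> path_event m ?x"
    unfolding path_event_def by auto
  have split: "path_event (Suc m) ?x
      = {\<omega>\<in>space M. X (Suc m) \<omega> = ?x (Suc m) \<and> (\<forall>l\<le>m. X l \<omega> = ?x l)}"
    unfolding path_event_def by (auto simp: le_Suc_eq)
  show ?thesis
  proof (cases "prob (path_event m x) = 0")
    case True
    then have "prob (path_event (Suc m) ?x) \<le> 0"
      using finite_measure_mono[OF sub] eq by simp
    then show ?thesis using True by (simp add: antisym)
  next
    case False
    then have "prob (path_event m ?x) > 0"
      unfolding eq by (simp add: zero_less_measure_iff)
    then have "cond_prob M (\<lambda>\<omega>. X (Suc m) \<omega> = ?x (Suc m)) (\<lambda>\<omega>. \<forall>l\<le>m. X l \<omega> = ?x l)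
        = P $ ?x m $ ?x (Suc m)"
      using markov unfolding markov_chain_def path_event_def by blast
    then have "prob (path_event (Suc m) ?x) / prob (path_event m ?x) = P $ x m $ j"
      unfolding cond_prob_def split by (simp add: path_event_def)
    then show ?thesis using False eq by (simp add: field_simps)
  qed
qed

lemma path_expansion:
  fixes F :: "(nat \<Rightarrow> 's) \<Rightarrow> 'b::real_vector"
  assumes "depends_on_past m F" "\<omega> \<in> space M"
  shows "F (trajectory \<omega>) = (\<Sum>x\<in>{..m} \<rightarrow>\<^sub>E UNIV. indicator (path_event m x) \<omega> *\<^sub>R F x)"
proof -
  define r where "r = restrict (trajectory \<omega>) {..m}"
  have r: "r \<in> {..m} \<rightarrow>\<^sub>E UNIV" unfolding r_def by auto
  have "indicator (path_event m x) \<omega> *\<^sub>R F x = (if x = r then F x else 0)"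
    if "x \<in> {..m} \<rightarrow>\<^sub>E UNIV" for x
  proof -
    have "\<omega> \<in> path_event m x \<longleftrightarrow> x = r"
      using that assms(2) unfolding path_event_def r_def
      by (auto simp: PiE_def extensional_def restrict_def fun_eq_iff)
    then show ?thesis by (auto simp: indicator_def)
  qed
  then have "(\<Sum>x\<in>{..m} \<rightarrow>\<^sub>E UNIV. indicator (path_event m x) \<omega> *\<^sub>R F x)
      = (\<Sum>x\<in>{..m} \<rightarrow>\<^sub>E UNIV. if x = r then F x else 0)"
    by (intro sum.cong) auto
  also have "\<dots> = F r" using r by (simp add: finite_PiE)
  also have "F r = F (trajectory \<omega>)"
    using assms(1) unfolding depends_on_past_def r_def by simp
  finally show ?thesis by simp
qed

lemma borel_measurable_past:
  fixes F :: "(nat \<Rightarrow> 's) \<Rightarrow> 'b::{real_normed_vector, second_countable_topology}"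
  assumes "depends_on_past m F"
  shows "(\<lambda>\<omega>. F (trajectory \<omega>)) \<in> borel_measurable M"
proof -
  have "(\<lambda>\<omega>. \<Sum>x\<in>{..m} \<rightarrow>\<^sub>E UNIV. indicator (path_event m x) \<omega> *\<^sub>R F x) \<in> borel_measurable M"
    by measurable
  then show ?thesis
    by (subst measurable_cong[OF path_expansion[OF assms]])
qed

lemma integrable_past:
  fixes F :: "(nat \<Rightarrow> 's) \<Rightarrow> 'b::{banach, second_countable_topology}"
  assumes "depends_on_past m F"
  shows "integrable M (\<lambda>\<omega>. F (trajectory \<omega>))"
proof -
  have "integrable M (\<lambda>\<omega>. \<Sum>x\<in>{..m} \<rightarrow>\<^sub>E UNIV. indicator (path_event m x) \<omega> *\<^sub>R F x)"
    by (intro Bochner_Integration.integrable_sum integrable_scaleR_left integrable_real_indicator)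
       (auto simp: less_top[symmetric])
  then show ?thesis
    by (subst Bochner_Integration.integrable_cong[OF refl path_expansion[OF assms]])
qed

lemma expectation_past:
  fixes F :: "(nat \<Rightarrow> 's) \<Rightarrow> 'b::{banach, second_countable_topology}"
  assumes "depends_on_past m F"
  shows "expectation (\<lambda>\<omega>. F (trajectory \<omega>))
       = (\<Sum>x\<in>{..m} \<rightarrow>\<^sub>E UNIV. prob (path_event m x) *\<^sub>R F x)"
proof -
  have i: "integrable M (indicat_real (path_event m x))" for x
    by (rule integrable_real_indicator) (auto simp: less_top[symmetric])
  have "expectation (\<lambda>\<omega>. F (trajectory \<omega>))
      = expectation (\<lambda>\<omega>. \<Sum>x\<in>{..m} \<rightarrow>\<^sub>E UNIV. indicator (path_event m x) \<omega> *\<^sub>R F x)"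
    by (rule Bochner_Integration.integral_cong[OF refl path_expansion[OF assms]])
  also have "\<dots> = (\<Sum>x\<in>{..m} \<rightarrow>\<^sub>E UNIV. prob (path_event m x) *\<^sub>R F x)"
    using i by (subst Bochner_Integration.integral_sum) (auto intro!: sum.cong)
  finally show ?thesis .
qed

text \<open>
  The Markov property in the form of an identity of expectations: given the past, the last step
  may be averaged with the transition probabilities out of the current state.
\<close>

theorem expectation_one_step:
  fixes F :: "(nat \<Rightarrow> 's) \<Rightarrow> 'b::{banach, second_countable_topology, real_normed_algebra}"
  assumes F: "depends_on_past m F"
  shows "expectation (\<lambda>\<omega>. F (trajectory \<omega>) * h (X m \<omega>) (X (Suc m) \<omega>))
       = expectation (\<lambda>\<omega>. F (trajectory \<omega>) * (\<Sum>j\<in>UNIV. P $ X m \<omega> $ j *\<^sub>R h (X m \<omega>) j))"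
proof -
  have i: "integrable M (indicat_real (path_event k x))" for k x
    by (rule integrable_real_indicator) (auto simp: less_top[symmetric])
  have "F (trajectory \<omega>) * h (X m \<omega>) (X (Suc m) \<omega>)
      = (\<Sum>x\<in>{..m} \<rightarrow>\<^sub>E UNIV. \<Sum>j\<in>UNIV.
           indicator (path_event (Suc m) (x(Suc m := j))) \<omega> *\<^sub>R (F x * h (x m) j))"
    if \<omega>: "\<omega> \<in> space M" for \<omega>
  proof -
    have "depends_on_past m (\<lambda>x. F x * h (x m) (X (Suc m) \<omega>))"
      using F unfolding depends_on_past_def by (metis order_refl)
    from path_expansion[OF this \<omega>]
    have "F (trajectory \<omega>) * h (X m \<omega>) (X (Suc m) \<omega>)
        = (\<Sum>x\<in>{..m} \<rightarrow>\<^sub>E UNIV. indicator (path_event m x) \<omega> *\<^sub>R (F x * h (x m) (X (Suc m) \<omega>)))" .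
    moreover have "indicator (path_event m x) \<omega> *\<^sub>R (F x * h (x m) (X (Suc m) \<omega>))
        = (\<Sum>j\<in>UNIV. indicator (path_event (Suc m) (x(Suc m := j))) \<omega> *\<^sub>R (F x * h (x m) j))" for x
    proof -
      have "\<omega> \<in> path_event (Suc m) (x(Suc m := j)) \<longleftrightarrow> \<omega> \<in> path_event m x \<and> j = X (Suc m) \<omega>" for j
        using \<omega> unfolding path_event_def by (auto simp: le_Suc_eq)
      then have "indicator (path_event (Suc m) (x(Suc m := j))) \<omega> *\<^sub>R (F x * h (x m) j)
          = (if j = X (Suc m) \<omega> then indicator (path_event m x) \<omega> *\<^sub>R (F x * h (x m) j) else 0)" for j
        by (auto simp: indicator_def)
      then show ?thesis by simp
    qed
    ultimately show ?thesis by simp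
  qed
  then have "expectation (\<lambda>\<omega>. F (trajectory \<omega>) * h (X m \<omega>) (X (Suc m) \<omega>))
      = expectation (\<lambda>\<omega>. \<Sum>x\<in>{..m} \<rightarrow>\<^sub>E UNIV. \<Sum>j\<in>UNIV.
           indicator (path_event (Suc m) (x(Suc m := j))) \<omega> *\<^sub>R (F x * h (x m) j))"
    by (rule Bochner_Integration.integral_cong[OF refl])
  also have "\<dots> = (\<Sum>x\<in>{..m} \<rightarrow>\<^sub>E UNIV. \<Sum>j\<in>UNIV.
      prob (path_event (Suc m) (x(Suc m := j))) *\<^sub>R (F x * h (x m) j))"
    by (subst Bochner_Integration.integral_sum,
        intro Bochner_Integration.integrable_sum integrable_scaleR_left i,
        rule sum.cong[OF refl], subst Bochner_Integration.integral_sum,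
        intro integrable_scaleR_left i, use i in simp)
  also have "\<dots> = (\<Sum>x\<in>{..m} \<rightarrow>\<^sub>E UNIV. prob (path_event m x) *\<^sub>R
      (F x * (\<Sum>j\<in>UNIV. P $ x m $ j *\<^sub>R h (x m) j)))"
    unfolding prob_path_event_Suc
    by (simp add: sum_distrib_left scaleR_sum_right)
  also have "\<dots> = expectation (\<lambda>\<omega>. F (trajectory \<omega>) * (\<Sum>j\<in>UNIV. P $ X m \<omega> $ j *\<^sub>R h (X m \<omega>) j))"
  proof -
    have "depends_on_past m (\<lambda>x. F x * (\<Sum>j\<in>UNIV. P $ x m $ j *\<^sub>R h (x m) j))"
      using F unfolding depends_on_past_def by (metis order_refl)
    from expectation_past[OF this] show ?thesis by simp
  qed
  finally show ?thesis .
qed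

end

section \<open>Centred additive functionals\<close>

text \<open>
  When the \<open>P\<close>-average of \<open>g i\<close> is zero for every state \<open>i\<close>, this is a martingale with bounded increments.
\<close>

definition additive_functional :: "('s \<Rightarrow> 's \<Rightarrow> real) \<Rightarrow> nat \<Rightarrow> (nat \<Rightarrow> 's) \<Rightarrow> real" where
  "additive_functional g n x = (\<Sum>m<n. g (x m) (x (Suc m)))"

lemma depends_on_past_additive_functional: "depends_on_past n (additive_functional g n)"
  unfolding depends_on_past_def additive_functional_def by (auto intro!: sum.cong)

lemma depends_on_past_comp:
  assumes "depends_on_past m F"
  shows "depends_on_past m (\<lambda>x. h (F x))"
  using assms unfolding depends_on_past_def by metis

context finite_markov_chain
begin

lemma additive_functional_measurable[measurable]:
  "(\<lambda>\<omega>. additive_functional g n (trajectory \<omega>)) \<in> borel_measurable M"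
  by (rule borel_measurable_past[OF depends_on_past_additive_functional])

text \<open>
  Increments of a martingale are orthogonal, so the second moment grows by at most \<open>C\<^sup>2\<close> per step.
\<close>

lemma second_moment_centred_additive_functional:
  assumes centred: "\<And>i. (\<Sum>j\<in>UNIV. P $ i $ j * g i j) = 0" and C: "\<And>i j. \<bar>g i j\<bar> \<le> C"
  shows "expectation (\<lambda>\<omega>. (additive_functional g n (trajectory \<omega>))\<^sup>2) \<le> real n * C\<^sup>2"
proof (induction n)
  case 0
  show ?case by (simp add: additive_functional_def)
next
  case (Suc n)
  let ?S = "additive_functional g n"
  have int: "integrable M (\<lambda>\<omega>. (?S (trajectory \<omega>))\<^sup>2)"
    by (rule integrable_past[OF depends_on_past_comp[OF depends_on_past_additive_functional]])
  have "depends_on_past (Suc n) (\<lambda>x. ?S x * g (x n) (x (Suc n)))"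
    using depends_on_past_additive_functional[of n g] unfolding depends_on_past_def
    by (metis le_Suc_eq order_refl)
  then have int2: "integrable M (\<lambda>\<omega>. ?S (trajectory \<omega>) * g (X n \<omega>) (X (Suc n) \<omega>))"
    by (rule integrable_past)
  have "depends_on_past (Suc n) (\<lambda>x. (g (x n) (x (Suc n)))\<^sup>2)"
    unfolding depends_on_past_def by simp
  then have int3: "integrable M (\<lambda>\<omega>. (g (X n \<omega>) (X (Suc n) \<omega>))\<^sup>2)"
    by (rule integrable_past)
  have "expectation (\<lambda>\<omega>. ?S (trajectory \<omega>) * g (X n \<omega>) (X (Suc n) \<omega>)) = 0"
    using expectation_one_step[OF depends_on_past_additive_functional, where h = g] centred by simp
  moreover have "expectation (\<lambda>\<omega>. (g (X n \<omega>) (X (Suc n) \<omega>))\<^sup>2) \<le> expectation (\<lambda>\<omega>. C\<^sup>2)"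
    using C int3 by (intro integral_mono) (auto simp: abs_le_square_iff[symmetric] intro: order_trans[OF _ abs_ge_self])
  moreover have "expectation (\<lambda>\<omega>. (additive_functional g (Suc n) (trajectory \<omega>))\<^sup>2)
      = expectation (\<lambda>\<omega>. (?S (trajectory \<omega>))\<^sup>2 + 2 * (?S (trajectory \<omega>) * g (X n \<omega>) (X (Suc n) \<omega>))
          + (g (X n \<omega>) (X (Suc n) \<omega>))\<^sup>2)"
    by (intro Bochner_Integration.integral_cong) (simp_all add: additive_functional_def power2_sum mult.assoc)
  ultimately show ?case
    using Suc int int2 int3 by (simp add: prob_space algebra_simps)
qed

end

section \<open>Central limit theorem for centred additive functionals\<close>

text \<open>
  The characteristic function of one step, at the frequency \<open>1 / sqrt n\<close>, is \<open>1 - a / (2 n)\<close> up to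
  \<open>O (n powr (-3 / 2))\<close>, because the step is centred with variance \<open>a\<close>. Multiplication by
  \<open>exp (a / (2 n))\<close> therefore leaves \<open>1\<close> up to an error \<open>o (1 / n)\<close>, which is small even after summation over
  \<open>n\<close> steps.
\<close>

lemma one_step_char_asymptotics:
  fixes p g :: "'s::finite \<Rightarrow> real"
  assumes p: "\<And>j. 0 \<le> p j" "(\<Sum>j\<in>UNIV. p j) = 1" and centred: "(\<Sum>j\<in>UNIV. p j * g j) = 0"
    and a: "a = (\<Sum>j\<in>UNIV. p j * (g j)\<^sup>2)"
  shows "(\<lambda>n. real n *\<^sub>R ((\<Sum>j\<in>UNIV. p j *\<^sub>R (iexp (g j / sqrt n) * exp (of_real (a / (2 * real n))))) - 1))
           \<longlonglongrightarrow> (0 :: complex)"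
proof -
  define q where "q n = (\<Sum>j\<in>UNIV. p j *\<^sub>R iexp (g j / sqrt (real n)))" for n
  define K where "K = (\<Sum>j\<in>UNIV. p j * \<bar>g j\<bar>^3)"
  have bound: "norm (q n - of_real (1 - a / (2 * real n))) \<le> K / sqrt n ^ 3" if n: "n > 0" for n :: nat
  proof -
    define t where "t = 1 / sqrt (real n)"
    have t2: "t\<^sup>2 = 1 / n" and t0: "t \<ge> 0" unfolding t_def by (simp_all add: power_divide)
    have "of_real (1 - a / (2 * real n)) = (\<Sum>j\<in>UNIV. p j *\<^sub>R (1 + \<i> * of_real (g j * t) + (\<i> * of_real (g j * t))\<^sup>2 / 2))"
    proof -
      have "(\<Sum>j\<in>UNIV. p j *\<^sub>R (1 + \<i> * of_real (g j * t) + (\<i> * of_real (g j * t))\<^sup>2 / 2))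
          = of_real (\<Sum>j\<in>UNIV. p j) + \<i> * t * of_real (\<Sum>j\<in>UNIV. p j * g j) - of_real (t\<^sup>2 / 2 * (\<Sum>j\<in>UNIV. p j * (g j)\<^sup>2))"
        by (simp add: scaleR_conv_of_real algebra_simps sum.distrib sum_subtractf sum_distrib_left
            power_mult_distrib sum_divide_distrib sum_negf)
      also have "\<dots> = of_real (1 - a / (2 * real n))"
        unfolding p centred a[symmetric] t2 by simp
      finally show ?thesis by simp
    qed
    then have "q n - of_real (1 - a / (2 * real n))
        = (\<Sum>j\<in>UNIV. p j *\<^sub>R (iexp (g j * t) - (1 + \<i> * of_real (g j * t) + (\<i> * of_real (g j * t))\<^sup>2 / 2)))"
      unfolding q_def t_def by (simp add: sum_subtractf scaleR_diff_right)
    also have "norm \<dots> \<le> (\<Sum>j\<in>UNIV. p j * (\<bar>g j * t\<bar>^3))"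
    proof (rule sum_norm_le)
      fix j
      have "norm (iexp (g j * t) - (1 + \<i> * of_real (g j * t) + (\<i> * of_real (g j * t))\<^sup>2 / 2))
          \<le> \<bar>g j * t\<bar>^3 / 6"
        using iexp_approx1[of "g j * t" 2] by (simp add: numeral_2_eq_2 numeral_3_eq_3 fact_numeral)
      also have "\<dots> \<le> \<bar>g j * t\<bar>^3" by simp
      finally show "norm (p j *\<^sub>R (iexp (g j * t) - (1 + \<i> * of_real (g j * t) + (\<i> * of_real (g j * t))\<^sup>2 / 2)))
          \<le> p j * (\<bar>g j * t\<bar>^3)"
        using p(1)[of j] by (simp add: mult_left_mono)
    qed
    also have "\<dots> = K * t^3" unfolding K_def using t0
      by (simp add: abs_mult power_mult_distrib sum_distrib_right mult.assoc)
    finally show ?thesis unfolding t_def by (simp add: power_divide)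
  qed
  have lim1: "(\<lambda>n. real n *\<^sub>R (q n - of_real (1 - a / (2 * real n)))) \<longlonglongrightarrow> 0"
  proof (rule Lim_null_comparison)
    show "\<forall>\<^sub>F n in sequentially. norm (real n *\<^sub>R (q n - of_real (1 - a / (2 * real n)))) \<le> K * (real n / sqrt n ^ 3)"
      using eventually_gt_at_top[of 0]
    proof eventually_elim
      case (elim n)
      from mult_left_mono[OF bound[OF elim], of "real n"] show ?case by (simp add: mult_ac)
    qed
    have "(\<lambda>n. real n / sqrt (real n) ^ 3) \<longlonglongrightarrow> 0" by real_asymp
    from tendsto_mult_right_zero[OF this] show "(\<lambda>n. K * (real n / sqrt (real n) ^ 3)) \<longlonglongrightarrow> 0" .
  qed
  have lim2: "(\<lambda>n. complex_of_real (exp (a / (2 * real n)))) \<longlonglongrightarrow> of_real 1"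
    by (intro tendsto_of_real) real_asymp
  have lim3: "(\<lambda>n. complex_of_real (real n * (exp (a / (2 * real n)) * (1 - a / (2 * real n)) - 1))) \<longlonglongrightarrow> of_real 0"
    by (intro tendsto_of_real) real_asymp
  have "(\<lambda>n. of_real (exp (a / (2 * real n))) * (real n *\<^sub>R (q n - of_real (1 - a / (2 * real n))))
      + of_real (real n * (exp (a / (2 * real n)) * (1 - a / (2 * real n)) - 1))) \<longlonglongrightarrow> of_real 1 * 0 + of_real 0"
    by (intro tendsto_add tendsto_mult lim1 lim2 lim3)
  moreover have "of_real (exp (a / (2 * real n))) * (real n *\<^sub>R (q n - of_real (1 - a / (2 * real n))))
      + of_real (real n * (exp (a / (2 * real n)) * (1 - a / (2 * real n)) - 1))
    = real n *\<^sub>R ((\<Sum>j\<in>UNIV. p j *\<^sub>R (iexp (g j / sqrt n) * exp (of_real (a / (2 * real n))))) - 1)" for n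
    unfolding q_def exp_of_real
    by (simp add: scaleR_conv_of_real sum_distrib_left algebra_simps sum_divide_distrib)
  ultimately show ?thesis by simp
qed

context finite_markov_chain
begin

text \<open>
  Compensating each step by the exponential of half its conditional variance turns the exponentials
  into an approximate martingale: by the one-step identity, passing from time \<open>m\<close> to \<open>m + 1\<close> changes the
  expectation of \<open>A n m\<close> by at most a constant times \<open>\<rho> n\<close>, and \<open>n * \<rho> n\<close> tends to zero.
\<close>

lemma char_compensated_tendsto_1:
  assumes centred: "\<And>i. (\<Sum>j\<in>UNIV. P $ i $ j * g i j) = 0"
    and a: "\<And>i. a i = (\<Sum>j\<in>UNIV. P $ i $ j * (g i j)\<^sup>2)"
  shows "(\<lambda>n. expectation (\<lambda>\<omega>. iexp (additive_functional g n (trajectory \<omega>) / sqrt n)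
            * of_real (exp ((\<Sum>l<n. a (X l \<omega>)) / (2 * real n))))) \<longlonglongrightarrow> 1"
proof -
  define r :: "nat \<Rightarrow> 's \<Rightarrow> complex" where "r n i =
    (\<Sum>j\<in>UNIV. P $ i $ j *\<^sub>R (iexp (g i j / sqrt (real n)) * exp (of_real (a i / (2 * real n))))) - 1" for n i
  define \<rho> where "\<rho> n = (\<Sum>i\<in>UNIV. norm (r n i))" for n
  define abar where "abar = (\<Sum>i\<in>UNIV. a i)"
  define A where "A n m x = iexp (additive_functional g m x / sqrt (real n))
      * of_real (exp ((\<Sum>l<m. a (x l)) / (2 * real n)))" for n m and x :: "nat \<Rightarrow> 's"
  have a0: "0 \<le> a i" for i unfolding a by (intro sum_nonneg mult_nonneg_nonneg P_nonneg) auto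
  have abar: "a i \<le> abar" for i unfolding abar_def by (intro member_le_sum a0) auto
  have A_past: "depends_on_past m (A n m)" for n m
    unfolding depends_on_past_def A_def additive_functional_def by (auto intro!: arg_cong2[where f = "(*)"] sum.cong)
  have r_lim: "(\<lambda>n. real n *\<^sub>R r n i) \<longlonglongrightarrow> 0" for i
    unfolding r_def 
    by (rule one_step_char_asymptotics[where p = "\<lambda>j. P $ i $ j" and g = "g i", OF P_nonneg P_sum centred a])
  have "(\<lambda>n. \<Sum>i\<in>UNIV. norm (real n *\<^sub>R r n i)) \<longlonglongrightarrow> (\<Sum>i\<in>(UNIV::'s set). 0)"
    by (intro tendsto_sum tendsto_norm_zero r_lim)
  then have \<rho>_lim: "(\<lambda>n. real n * \<rho> n) \<longlonglongrightarrow> 0"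
    unfolding \<rho>_def by (simp add: sum_distrib_left)
  \<comment> \<open>The compensator stays bounded because only \<open>n\<close> steps of conditional variance \<open>a i / n\<close> are accumulated.\<close>
  have A_bound: "norm (A n m x) \<le> exp (abar / 2)" if "m \<le> n" for n m x
  proof (cases "n = 0")
    case True
    then show ?thesis using that abar[THEN order_trans[OF a0]] unfolding A_def by (simp add: additive_functional_def)
  next
    case False
    have "(\<Sum>l<m. a (x l)) \<le> real m * abar"
      using sum_bounded_above[of "{..<m}" "\<lambda>l. a (x l)" abar] abar by simp
    also have "\<dots> \<le> real n * abar" using that abar[THEN order_trans[OF a0]] by (intro mult_right_mono) auto
    finally have "(\<Sum>l<m. a (x l)) / (2 * real n) \<le> abar / 2"
      using False by (simp add: field_simps)
    then show ?thesis unfolding A_def by (simp add: norm_mult)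
  qed
  have step: "norm (expectation (\<lambda>\<omega>. A n (Suc m) (trajectory \<omega>)) - expectation (\<lambda>\<omega>. A n m (trajectory \<omega>)))
      \<le> exp (abar / 2) * \<rho> n" if "m < n" for n m
  proof -
    define h where "h i j = iexp (g i j / sqrt (real n)) * exp (of_real (a i / (2 * real n)))" for i j
    have "A n (Suc m) x = A n m x * h (x m) (x (Suc m))" for x
      unfolding A_def h_def additive_functional_def
      by (simp add: add_divide_distrib exp_add distrib_left exp_of_real[symmetric] mult_ac)
    then have "expectation (\<lambda>\<omega>. A n (Suc m) (trajectory \<omega>))
        = expectation (\<lambda>\<omega>. A n m (trajectory \<omega>) * (\<Sum>j\<in>UNIV. P $ X m \<omega> $ j *\<^sub>R h (X m \<omega>) j))"
      using expectation_one_step[OF A_past, where h = h] by simp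
    also have "\<dots> = expectation (\<lambda>\<omega>. A n m (trajectory \<omega>) * (1 + r n (X m \<omega>)))"
      unfolding r_def h_def by simp
    also have "\<dots> = expectation (\<lambda>\<omega>. A n m (trajectory \<omega>) + A n m (trajectory \<omega>) * r n (X m \<omega>))"
      by (simp add: distrib_left)
    also have "\<dots> = expectation (\<lambda>\<omega>. A n m (trajectory \<omega>)) + expectation (\<lambda>\<omega>. A n m (trajectory \<omega>) * r n (X m \<omega>))"
    proof (rule Bochner_Integration.integral_add)
      show "integrable M (\<lambda>\<omega>. A n m (trajectory \<omega>))" by (rule integrable_past[OF A_past])
      have "depends_on_past m (\<lambda>x. A n m x * r n (x m))"
        using A_past[of m n] unfolding depends_on_past_def by (metis order_refl)
      from integrable_past[OF this] show "integrable M (\<lambda>\<omega>. A n m (trajectory \<omega>) * r n (X m \<omega>))" .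
    qed
    finally have "norm (expectation (\<lambda>\<omega>. A n (Suc m) (trajectory \<omega>)) - expectation (\<lambda>\<omega>. A n m (trajectory \<omega>)))
        = norm (expectation (\<lambda>\<omega>. A n m (trajectory \<omega>) * r n (X m \<omega>)))" by simp
    also have "\<dots> \<le> exp (abar / 2) * \<rho> n + (exp (abar / 2) * \<rho> n) * prob {}"
    proof (rule integral_norm_le_of_prob)
      have "depends_on_past m (\<lambda>x. A n m x * r n (x m))"
        using A_past[of m n] unfolding depends_on_past_def by (metis order_refl)
      from borel_measurable_past[OF this]
      show "(\<lambda>\<omega>. A n m (trajectory \<omega>) * r n (X m \<omega>)) \<in> borel_measurable M" .
      have "norm (r n i) \<le> \<rho> n" for i unfolding \<rho>_def by (rule member_le_sum) auto
      then have "norm (A n m (trajectory \<omega>) * r n (X m \<omega>)) \<le> exp (abar / 2) * \<rho> n" for \<omega>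
        unfolding norm_mult using A_bound[of m n] that by (intro mult_mono) auto
      then show "norm (A n m (trajectory \<omega>) * r n (X m \<omega>)) \<le> exp (abar / 2) * \<rho> n"
        "norm (A n m (trajectory \<omega>) * r n (X m \<omega>)) \<le> exp (abar / 2) * \<rho> n" for \<omega>
        by blast+
      show "0 \<le> exp (abar / 2) * \<rho> n" "0 \<le> exp (abar / 2) * \<rho> n"
        unfolding \<rho>_def by (intro mult_nonneg_nonneg sum_nonneg; simp)+
    qed simp
    finally show ?thesis by simp
  qed
  have "norm (expectation (\<lambda>\<omega>. A n n (trajectory \<omega>)) - 1) \<le> exp (abar / 2) * (real n * \<rho> n)" for n
  proof -
    have "norm (expectation (\<lambda>\<omega>. A n m (trajectory \<omega>)) - 1) \<le> real m * (exp (abar / 2) * \<rho> n)"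
      if "m \<le> n" for m
      using that
    proof (induction m)
      case 0
      show ?case by (simp add: A_def additive_functional_def prob_space)
    next
      case (Suc m)
      then have "norm (expectation (\<lambda>\<omega>. A n m (trajectory \<omega>)) - 1) \<le> real m * (exp (abar / 2) * \<rho> n)" by simp
      with norm_triangle_ineq[of "expectation (\<lambda>\<omega>. A n (Suc m) (trajectory \<omega>)) - expectation (\<lambda>\<omega>. A n m (trajectory \<omega>))"
          "expectation (\<lambda>\<omega>. A n m (trajectory \<omega>)) - 1"] step[of m n] Suc.prems
      show ?case by (simp add: algebra_simps)
    qed
    from this[of n] show ?thesis by (simp add: mult_ac)
  qed
  then have "(\<lambda>n. expectation (\<lambda>\<omega>. A n n (trajectory \<omega>)) - 1) \<longlonglongrightarrow> 0"
    by (intro Lim_null_comparison[OF _ tendsto_mult_right_zero[OF \<rho>_lim]] always_eventually) blast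
  then have "(\<lambda>n. expectation (\<lambda>\<omega>. A n n (trajectory \<omega>))) \<longlonglongrightarrow> 1"
    by (simp add: LIM_zero_iff)
  then show ?thesis unfolding A_def .
qed

text \<open>
  The law of large numbers makes the accumulated conditional variance asymptotically deterministic,
  so the compensating factor may be replaced by the constant \<open>exp (v / 2)\<close> and taken out of the
  expectation.
\<close>

theorem additive_functional_clt:
  assumes centred: "\<And>i. (\<Sum>j\<in>UNIV. P $ i $ j * g i j) = 0"
    and a: "\<And>i. a i = (\<Sum>j\<in>UNIV. P $ i $ j * (g i j)\<^sup>2)"
    and lln: "vanishes_in_prob M (\<lambda>n \<omega>. (\<Sum>l<n. a (X l \<omega>)) / n - v)"
  shows "(\<lambda>n. expectation (\<lambda>\<omega>. iexp (additive_functional g n (trajectory \<omega>) / sqrt n)))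
            \<longlonglongrightarrow> of_real (exp (- v / 2))"
proof -
  define V where "V n \<omega> = (\<Sum>l<n. a (X l \<omega>)) / n" for n \<omega>
  define abar where "abar = (\<Sum>i\<in>UNIV. a i)"
  have a0: "0 \<le> a i" for i unfolding a by (intro sum_nonneg mult_nonneg_nonneg P_nonneg) auto
  have abar: "a i \<le> abar" for i unfolding abar_def by (intro member_le_sum a0) auto
  have V_bound: "0 \<le> V n \<omega>" "V n \<omega> \<le> abar" for n \<omega>
  proof -
    show "0 \<le> V n \<omega>" unfolding V_def by (intro divide_nonneg_nonneg sum_nonneg a0) auto
    have "(\<Sum>l<n. a (X l \<omega>)) \<le> real n * abar"
      using sum_bounded_above[of "{..<n}" "\<lambda>l. a (X l \<omega>)" abar] abar by simp
    then show "V n \<omega> \<le> abar" unfolding V_def using abar[THEN order_trans[OF a0]]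
      by (cases "n = 0") (auto simp: field_simps)
  qed
  have V_meas[measurable]: "V n \<in> borel_measurable M" for n unfolding V_def by measurable
  define Y where "Y n \<omega> = iexp (additive_functional g n (trajectory \<omega>) / sqrt (real n))" for n \<omega>
  have Y_meas[measurable]: "Y n \<in> borel_measurable M" for n unfolding Y_def by measurable
  have Y_norm: "norm (Y n \<omega>) = 1" for n \<omega> unfolding Y_def by simp
  have "isCont (\<lambda>u::real. exp (u / 2)) v" by (intro continuous_intros) auto
  then have cont: "\<exists>\<delta>>0. \<forall>u. \<bar>u - v\<bar> < \<delta> \<longrightarrow> \<bar>exp (u / 2) - exp (v / 2)\<bar> < \<eta>" if "\<eta> > 0" for \<eta>
    using that unfolding continuous_at_eps_delta by (auto simp: dist_real_def)
  have "vanishes_in_prob M (\<lambda>n \<omega>. Y n \<omega> * of_real (exp (V n \<omega> / 2) - exp (v / 2)))"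
  proof (rule vanishes_in_prob_small_multiple[where A = "\<lambda>n \<omega>. V n \<omega> - v" and Y = "\<lambda>n \<omega>. 1::real"])
    show "vanishes_in_prob M (\<lambda>n \<omega>. V n \<omega> - v)" using lln unfolding V_def .
    show "bounded_in_prob M (\<lambda>n \<omega>. 1::real)" by (rule bounded_in_prob_const)
    fix \<eta> :: real assume "\<eta> > 0"
    from cont[OF this] obtain \<delta> where \<delta>: "\<delta> > 0"
      "\<And>u. \<bar>u - v\<bar> < \<delta> \<Longrightarrow> \<bar>exp (u / 2) - exp (v / 2)\<bar> < \<eta>" by blast
    show "\<exists>\<delta>>0. \<forall>\<^sub>F n in sequentially. \<forall>\<omega>\<in>space M. norm (V n \<omega> - v) \<le> \<delta> \<longrightarrow>
        norm (Y n \<omega> * of_real (exp (V n \<omega> / 2) - exp (v / 2))) \<le> \<eta> * norm (1::real)"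
    proof (intro exI[of _ "\<delta> / 2"] conjI always_eventually allI ballI impI)
      fix n \<omega> assume "norm (V n \<omega> - v) \<le> \<delta> / 2"
      then have "\<bar>V n \<omega> - v\<bar> < \<delta>" using \<delta>(1) unfolding real_norm_def by linarith
      from \<delta>(2)[OF this] show "norm (Y n \<omega> * of_real (exp (V n \<omega> / 2) - exp (v / 2))) \<le> \<eta> * norm (1::real)"
        unfolding norm_mult Y_norm norm_of_real by simp
    qed (use \<delta> in simp)
  qed measurable
  then have "(\<lambda>n. expectation (\<lambda>\<omega>. Y n \<omega> * of_real (exp (V n \<omega> / 2) - exp (v / 2)))) \<longlonglongrightarrow> 0"
  proof (rule bounded_convergence_in_prob[rotated 2, where B = "exp (abar / 2) + exp (v / 2)"])
    fix n \<omega>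
    have "\<bar>exp (V n \<omega> / 2) - exp (v / 2)\<bar> \<le> \<bar>exp (V n \<omega> / 2)\<bar> + \<bar>exp (v / 2)\<bar>" by (rule abs_triangle_ineq4)
    also have "\<dots> \<le> exp (abar / 2) + exp (v / 2)" using V_bound[of n \<omega>] by simp
    finally show "norm (Y n \<omega> * of_real (exp (V n \<omega> / 2) - exp (v / 2))) \<le> exp (abar / 2) + exp (v / 2)"
      unfolding norm_mult Y_norm norm_of_real by simp
  qed measurable
  moreover have "expectation (\<lambda>\<omega>. Y n \<omega> * of_real (exp (V n \<omega> / 2) - exp (v / 2)))
      = expectation (\<lambda>\<omega>. Y n \<omega> * of_real (exp (V n \<omega> / 2))) - expectation (Y n) * of_real (exp (v / 2))" for n
  proof -
    have "integrable M (Y n)" by (rule integrable_const_bound[of _ 1]) (auto simp: Y_norm)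
    moreover have "integrable M (\<lambda>\<omega>. Y n \<omega> * of_real (exp (V n \<omega> / 2)))"
      by (rule integrable_const_bound[of _ "exp (abar / 2)"]) (auto simp: norm_mult Y_norm V_bound)
    ultimately show ?thesis by (simp add: right_diff_distrib)
  qed
  ultimately have "(\<lambda>n. expectation (\<lambda>\<omega>. Y n \<omega> * of_real (exp (V n \<omega> / 2))) - expectation (Y n) * of_real (exp (v / 2))) \<longlonglongrightarrow> 0"
    by simp
  moreover have "(\<lambda>n. expectation (\<lambda>\<omega>. Y n \<omega> * of_real (exp (V n \<omega> / 2)))) \<longlonglongrightarrow> 1"
    using char_compensated_tendsto_1[OF centred a] unfolding Y_def V_def by (simp add: mult.commute)
  ultimately have "(\<lambda>n. expectation (\<lambda>\<omega>. Y n \<omega> * of_real (exp (V n \<omega> / 2)))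
      - (expectation (\<lambda>\<omega>. Y n \<omega> * of_real (exp (V n \<omega> / 2))) - expectation (Y n) * of_real (exp (v / 2)))) \<longlonglongrightarrow> 1 - 0"
    by (rule tendsto_diff[rotated])
  from tendsto_mult_right[OF this, of "of_real (exp (- v / 2))"]
  have "(\<lambda>n. expectation (Y n) * (of_real (exp (v / 2)) * of_real (exp (- v / 2)))) \<longlonglongrightarrow> of_real (exp (- v / 2))"
    by (simp add: mult.assoc)
  moreover have "complex_of_real (exp (v / 2)) * of_real (exp (- v / 2)) = 1"
    by (simp add: of_real_mult[symmetric] exp_add[symmetric] del: of_real_mult)
  ultimately show ?thesis unfolding Y_def by simp
qed

end

section \<open>Gaussian random elements\<close>

text \<open>
  Reduces moments and characteristic functions to the standard normal law, with the degenerate case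
  \<open>v = 0\<close> included.
\<close>

lemma normal_law_eq_affine_image:
  assumes "0 \<le> v"
  shows "normal_law \<mu> v = distr std_normal_distribution borel (\<lambda>x. \<mu> + sqrt v * x)"
proof -
  interpret std: real_distribution std_normal_distribution by (rule real_dist_normal_dist)
  show ?thesis
  proof (cases "v = 0")
    case True
    then show ?thesis by (simp add: normal_law_def std.distr_const)
  next
    case False
    have "distributed std_normal_distribution lborel (\<lambda>x. x) std_normal_density"
      unfolding distributed_def by (auto simp: distr_id2)
    from std.normal_density_affine[OF this, of "sqrt v" \<mu>] False assms
    have "distributed std_normal_distribution lborel (\<lambda>x. \<mu> + sqrt v * x) (normal_density \<mu> (sqrt v))"
      by simp
    then have "distr std_normal_distribution lborel (\<lambda>x. \<mu> + sqrt v * x) = density lborel (normal_density \<mu> (sqrt v))"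
      by (rule distributed_distr_eq_density)
    moreover have "distr std_normal_distribution lborel (\<lambda>x. \<mu> + sqrt v * x)
        = distr std_normal_distribution borel (\<lambda>x. \<mu> + sqrt v * x)"
      by (rule distr_cong) auto
    ultimately show ?thesis using False by (simp add: normal_law_def)
  qed
qed

lemma normal_law_moments:
  assumes v: "0 \<le> v"
  shows "integrable (normal_law \<mu> v) (\<lambda>x. x)" "integral\<^sup>L (normal_law \<mu> v) (\<lambda>x. x) = \<mu>"
    and "integrable (normal_law \<mu> v) (\<lambda>x. x\<^sup>2)"
    and "integral\<^sup>L (normal_law \<mu> v) (\<lambda>x. (x - \<mu>)\<^sup>2) = v"
    and "integral\<^sup>L (normal_law \<mu> v) iexp = iexp \<mu> * of_real (exp (- v / 2))"
proof -
  define D where "D = std_normal_distribution"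
  interpret D: real_distribution D unfolding D_def by (rule real_dist_normal_dist)
  have i1: "integrable D (\<lambda>x. x)"
    using integrable_std_normal_distribution_moment[of 1] unfolding D_def power_one_right .
  have e1: "integral\<^sup>L D (\<lambda>x. x) = 0"
    using integral_std_normal_distribution_moment_odd[OF odd_one] unfolding D_def power_one_right .
  have i2: "integrable D (\<lambda>x. x\<^sup>2)"
    unfolding D_def by (rule integrable_std_normal_distribution_moment)
  have e2: "integral\<^sup>L D (\<lambda>x. x\<^sup>2) = 1"
    using std_normal_distribution_even_moments(1)[of 1, folded D_def] by simp
  have law: "normal_law \<mu> v = distr D borel (\<lambda>x. \<mu> + sqrt v * x)"
    unfolding D_def by (rule normal_law_eq_affine_image[OF v])
  have meas: "(\<lambda>x. \<mu> + sqrt v * x) \<in> D \<rightarrow>\<^sub>M borel"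
    by simp
  have int_law: "integrable (normal_law \<mu> v) f \<longleftrightarrow> integrable D (\<lambda>x. f (\<mu> + sqrt v * x))"
    and exp_law: "integral\<^sup>L (normal_law \<mu> v) f = integral\<^sup>L D (\<lambda>x. f (\<mu> + sqrt v * x))"
    if "f \<in> borel_measurable borel" for f :: "real \<Rightarrow> real"
    unfolding law by (rule integrable_distr_eq[OF meas that], rule integral_distr[OF meas that])
  have id: "(\<lambda>x::real. x) \<in> borel_measurable borel" "(\<lambda>x::real. x\<^sup>2) \<in> borel_measurable borel"
    "(\<lambda>x::real. (x - \<mu>)\<^sup>2) \<in> borel_measurable borel" by measurable
  have c: "integrable D (\<lambda>x. c)" "integral\<^sup>L D (\<lambda>x. c) = c" for c :: real
    using D.prob_space by simp_all
  have lin: "integrable D (\<lambda>x. sqrt v * x)" by (rule integrable_mult_right) (rule i1)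
  show "integrable (normal_law \<mu> v) (\<lambda>x. x)"
    unfolding int_law[OF id(1)] by (rule Bochner_Integration.integrable_add[OF c(1) lin])
  show "integral\<^sup>L (normal_law \<mu> v) (\<lambda>x. x) = \<mu>"
    unfolding exp_law[OF id(1)] Bochner_Integration.integral_add[OF c(1) lin] integral_mult_right_zero e1 c
    by simp
  have sq: "(\<mu> + sqrt v * x)\<^sup>2 = \<mu>\<^sup>2 + (v * x\<^sup>2 + (2 * \<mu> * sqrt v) * x)" for x
    using v by (simp add: power2_sum power_mult_distrib)
  show "integrable (normal_law \<mu> v) (\<lambda>x. x\<^sup>2)"
    unfolding int_law[OF id(2)] sq
    by (intro Bochner_Integration.integrable_add c(1) integrable_mult_right i1 i2)
  have "(\<mu> + sqrt v * x - \<mu>)\<^sup>2 = v * x\<^sup>2" for x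
    using v by (simp add: power_mult_distrib)
  then show "integral\<^sup>L (normal_law \<mu> v) (\<lambda>x. (x - \<mu>)\<^sup>2) = v"
    unfolding exp_law[OF id(3)] by (simp only: integral_mult_right_zero e2)
  have "integral\<^sup>L (normal_law \<mu> v) iexp = integral\<^sup>L D (\<lambda>x. iexp \<mu> * iexp (sqrt v * x))"
    unfolding law by (subst integral_distr) (auto simp: distrib_left exp_add)
  also have "\<dots> = iexp \<mu> * char D (sqrt v)" unfolding char_def by simp
  finally show "integral\<^sup>L (normal_law \<mu> v) iexp = iexp \<mu> * of_real (exp (- v / 2))"
    using v unfolding D_def char_std_normal_distribution by simp
qed

lemma gaussian_inner:
  assumes "gaussian N Y"
  shows "integrable N (\<lambda>\<omega>. a \<bullet> Y \<omega>)" "integrable N (\<lambda>\<omega>. (a \<bullet> Y \<omega>)\<^sup>2)"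
    and "integral\<^sup>L N (\<lambda>\<omega>. iexp (a \<bullet> Y \<omega>))
       = iexp (integral\<^sup>L N (\<lambda>\<omega>. a \<bullet> Y \<omega>))
         * of_real (exp (- covariance N (\<lambda>\<omega>. a \<bullet> Y \<omega>) (\<lambda>\<omega>. a \<bullet> Y \<omega>) / 2))"
proof -
  have [measurable]: "Y \<in> borel_measurable N" using assms unfolding gaussian_def by blast
  obtain \<mu> v where v: "0 \<le> v" and law: "distr N borel (\<lambda>\<omega>. a \<bullet> Y \<omega>) = normal_law \<mu> v"
    using assms unfolding gaussian_def by blast
  note m = normal_law_moments[OF v, of \<mu>, folded law]
  show "integrable N (\<lambda>\<omega>. a \<bullet> Y \<omega>)" "integrable N (\<lambda>\<omega>. (a \<bullet> Y \<omega>)\<^sup>2)"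
    using m(1,3) by (auto simp: integrable_distr_eq)
  have "integral\<^sup>L N (\<lambda>\<omega>. a \<bullet> Y \<omega>) = \<mu>"
    using m(2) by (simp add: integral_distr)
  moreover have "integral\<^sup>L N (\<lambda>\<omega>. (a \<bullet> Y \<omega> - \<mu>)\<^sup>2) = v"
    using m(4) by (simp add: integral_distr)
  moreover have "integral\<^sup>L N (\<lambda>\<omega>. iexp (a \<bullet> Y \<omega>)) = iexp \<mu> * of_real (exp (- v / 2))"
    using m(5) by (simp add: integral_distr)
  ultimately show "integral\<^sup>L N (\<lambda>\<omega>. iexp (a \<bullet> Y \<omega>))
       = iexp (integral\<^sup>L N (\<lambda>\<omega>. a \<bullet> Y \<omega>))
         * of_real (exp (- covariance N (\<lambda>\<omega>. a \<bullet> Y \<omega>) (\<lambda>\<omega>. a \<bullet> Y \<omega>) / 2))"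
    by (simp add: covariance_def power2_eq_square[symmetric])
qed

lemma gaussian_integrable:
  fixes Y :: "'b \<Rightarrow> 'v::euclidean_space"
  assumes "gaussian N Y"
  shows "integrable N Y"
proof -
  have "integrable N (\<lambda>\<omega>. \<Sum>b\<in>Basis. (b \<bullet> Y \<omega>) *\<^sub>R b)"
    by (rule Bochner_Integration.integrable_sum, rule integrable_scaleR_left, rule gaussian_inner(1)[OF assms])
  moreover have "(\<Sum>b\<in>Basis. (b \<bullet> Y \<omega>) *\<^sub>R b) = Y \<omega>" for \<omega>
    unfolding inner_commute[of _ "Y \<omega>"] by (rule euclidean_representation)
  ultimately show ?thesis by simp
qed

text \<open>
  A linear functional of the image is a linear functional of the original, by passing to the adjoint.
\<close>

lemma gaussian_linear_image:
  fixes f :: "'v::euclidean_space \<Rightarrow> 'w::euclidean_space"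
  assumes Y: "gaussian N Y" and f: "linear f"
  shows "gaussian N (\<lambda>\<omega>. f (Y \<omega>))"
proof -
  have [measurable]: "f \<in> borel_measurable borel"
    using f by (intro borel_measurable_continuous_onI linear_continuous_on)
      (simp add: linear_conv_bounded_linear)
  have "a \<bullet> f (Y \<omega>) = adjoint f a \<bullet> Y \<omega>" for a \<omega>
    by (simp add: adjoint_clauses[OF f])
  then show ?thesis using Y unfolding gaussian_def by auto
qed

lemma covariance_sum:
  fixes U :: "'i \<Rightarrow> 'b \<Rightarrow> real" and V :: "'j \<Rightarrow> 'b \<Rightarrow> real"
  assumes "prob_space N" "finite I" "finite J"
    and U: "\<And>i. i \<in> I \<Longrightarrow> U i \<in> borel_measurable N" "\<And>i. i \<in> I \<Longrightarrow> integrable N (\<lambda>\<omega>. (U i \<omega>)\<^sup>2)"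
    and V: "\<And>j. j \<in> J \<Longrightarrow> V j \<in> borel_measurable N" "\<And>j. j \<in> J \<Longrightarrow> integrable N (\<lambda>\<omega>. (V j \<omega>)\<^sup>2)"
  shows "covariance N (\<lambda>\<omega>. \<Sum>i\<in>I. c i * U i \<omega>) (\<lambda>\<omega>. \<Sum>j\<in>J. d j * V j \<omega>)
       = (\<Sum>i\<in>I. \<Sum>j\<in>J. c i * d j * covariance N (U i) (V j))"
proof -
  interpret prob_space N by fact
  have iU: "integrable N (U i)" if "i \<in> I" for i
    using square_integrable_imp_integrable[OF U[OF that]] by simp
  have iV: "integrable N (V j)" if "j \<in> J" for j
    using square_integrable_imp_integrable[OF V[OF that]] by simp
  have eU: "expectation (\<lambda>\<omega>. \<Sum>i\<in>I. c i * U i \<omega>) = (\<Sum>i\<in>I. c i * expectation (U i))"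
    using iU by (subst Bochner_Integration.integral_sum) auto
  have eV: "expectation (\<lambda>\<omega>. \<Sum>j\<in>J. d j * V j \<omega>) = (\<Sum>j\<in>J. d j * expectation (V j))"
    using iV by (subst Bochner_Integration.integral_sum) auto
  have int: "integrable N (\<lambda>\<omega>. (U i \<omega> - expectation (U i)) * (V j \<omega> - expectation (V j)))"
    if "i \<in> I" "j \<in> J" for i j
  proof (rule Bochner_Integration.integrable_bound)
    note [measurable] = U(1)[OF that(1)] V(1)[OF that(2)]
    show "integrable N (\<lambda>\<omega>. (U i \<omega> - expectation (U i))\<^sup>2 + (V j \<omega> - expectation (V j))\<^sup>2)"
      using that U(2) V(2) iU iV by (simp add: power2_diff)
    show "(\<lambda>\<omega>. (U i \<omega> - expectation (U i)) * (V j \<omega> - expectation (V j))) \<in> borel_measurable N"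
      by measurable
    have "\<bar>x * y\<bar> \<le> x\<^sup>2 + y\<^sup>2" for x y :: real
      using sum_squares_bound[of "\<bar>x\<bar>" "\<bar>y\<bar>"] mult_nonneg_nonneg[of "\<bar>x\<bar>" "\<bar>y\<bar>"]
      unfolding abs_mult power2_abs by linarith
    then show "AE \<omega> in N. norm ((U i \<omega> - expectation (U i)) * (V j \<omega> - expectation (V j)))
        \<le> norm ((U i \<omega> - expectation (U i))\<^sup>2 + (V j \<omega> - expectation (V j))\<^sup>2)"
      by simp
  qed
  have "((\<Sum>i\<in>I. c i * U i \<omega>) - (\<Sum>i\<in>I. c i * expectation (U i)))
      * ((\<Sum>j\<in>J. d j * V j \<omega>) - (\<Sum>j\<in>J. d j * expectation (V j)))
    = (\<Sum>i\<in>I. \<Sum>j\<in>J. c i * d j * ((U i \<omega> - expectation (U i)) * (V j \<omega> - expectation (V j))))" for \<omega>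
    by (simp only: sum_subtractf[symmetric] right_diff_distrib[symmetric] sum_product)
       (simp add: mult_ac)
  then have "covariance N (\<lambda>\<omega>. \<Sum>i\<in>I. c i * U i \<omega>) (\<lambda>\<omega>. \<Sum>j\<in>J. d j * V j \<omega>)
    = expectation (\<lambda>\<omega>. \<Sum>i\<in>I. \<Sum>j\<in>J. c i * d j * ((U i \<omega> - expectation (U i)) * (V j \<omega> - expectation (V j))))"
    unfolding covariance_def eU eV by simp
  also have "\<dots> = (\<Sum>i\<in>I. \<Sum>j\<in>J. c i * d j * covariance N (U i) (V j))"
    unfolding covariance_def using int
    by (subst Bochner_Integration.integral_sum, intro Bochner_Integration.integrable_sum integrable_mult_right, simp,
        intro sum.cong refl, subst Bochner_Integration.integral_sum) auto
  finally show ?thesis .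
qed

lemma gaussian_component:
  fixes Y :: "'b \<Rightarrow> real^'n::finite"
  assumes "gaussian N Y"
  shows "(\<lambda>\<omega>. Y \<omega> $ i) \<in> borel_measurable N" "integrable N (\<lambda>\<omega>. (Y \<omega> $ i)\<^sup>2)"
proof -
  have [measurable]: "Y \<in> borel_measurable N" using assms unfolding gaussian_def by blast
  have eq: "axis i 1 \<bullet> Y \<omega> = Y \<omega> $ i" for \<omega> by (simp add: inner_axis')
  then show "(\<lambda>\<omega>. Y \<omega> $ i) \<in> borel_measurable N"
    using borel_measurable_inner[of "\<lambda>_. axis i 1" N Y] by simp
  show "integrable N (\<lambda>\<omega>. (Y \<omega> $ i)\<^sup>2)"
    using gaussian_inner(2)[OF assms, of "axis i 1"] eq by simp
qed

lemma covariance_matrix_linear_image: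
  fixes Y :: "'b \<Rightarrow> real^'n::finite" and A :: "real^'n^'m::finite"
  assumes Y: "gaussian N Y"
  shows "covariance_matrix N (\<lambda>\<omega>. A *v Y \<omega>) = A ** covariance_matrix N Y ** transpose A"
proof -
  have "prob_space N" using Y unfolding gaussian_def by blast
  from covariance_sum[OF this finite finite gaussian_component[OF Y] gaussian_component[OF Y]]
  have "covariance N (\<lambda>\<omega>. (A *v Y \<omega>) $ i) (\<lambda>\<omega>. (A *v Y \<omega>) $ j)
      = (\<Sum>k\<in>UNIV. \<Sum>l\<in>UNIV. A $ i $ k * A $ j $ l * covariance N (\<lambda>\<omega>. Y \<omega> $ k) (\<lambda>\<omega>. Y \<omega> $ l))" for i j
    by (simp add: matrix_vector_mult_def)
  moreover have "(A ** covariance_matrix N Y ** transpose A) $ i $ j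
      = (\<Sum>l\<in>UNIV. \<Sum>k\<in>UNIV. A $ i $ k * A $ j $ l * covariance N (\<lambda>\<omega>. Y \<omega> $ k) (\<lambda>\<omega>. Y \<omega> $ l))" for i j
    by (simp add: matrix_matrix_mult_def transpose_def covariance_matrix_def sum_distrib_right
        sum_distrib_left mult_ac)
  ultimately have "covariance N (\<lambda>\<omega>. (A *v Y \<omega>) $ i) (\<lambda>\<omega>. (A *v Y \<omega>) $ j)
      = (A ** covariance_matrix N Y ** transpose A) $ i $ j" for i j
    by (simp only:) (rule sum.swap)
  then show ?thesis
    unfolding covariance_matrix_def[of N "\<lambda>\<omega>. A *v Y \<omega>"] vec_eq_iff vec_lambda_beta by blast
qed

lemma multivariate_normal_linear_image:
  fixes Y :: "'b \<Rightarrow> real^'n::finite" and A :: "real^'n^'m::finite"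
  assumes "multivariate_normal N Y \<mu> \<Sigma>"
  shows "multivariate_normal N (\<lambda>\<omega>. A *v Y \<omega>) (A *v \<mu>) (A ** \<Sigma> ** transpose A)"
proof -
  have Y: "gaussian N Y" and m: "integral\<^sup>L N Y = \<mu>" and c: "covariance_matrix N Y = \<Sigma>"
    using assms unfolding multivariate_normal_def by auto
  have "integral\<^sup>L N (\<lambda>\<omega>. A *v Y \<omega>) = A *v integral\<^sup>L N Y"
    by (rule integral_bounded_linear[OF _ gaussian_integrable[OF Y]])
       (simp add: linear_conv_bounded_linear[symmetric])
  then show ?thesis
    unfolding multivariate_normal_def
    using gaussian_linear_image[OF Y, of "(*v) A"] covariance_matrix_linear_image[OF Y, of A] m c by simp
qed

section \<open>The limiting Gaussian matrix\<close>

lemma vec_cols_transpose_nth: "vec_cols (transpose A) $ a = A $ fst a $ snd a"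
  by (simp add: vec_cols_def transpose_def)

lemma linear_vec_cols_transpose: "linear (\<lambda>A :: real^'n::finite^'m::finite. vec_cols (transpose A))"
  by (rule linearI) (simp_all add: vec_eq_iff vec_cols_transpose_nth)

text \<open>
  Stacking the rows of a matrix indexes its entries by (row, column), and in this order the prescribed
  covariances of the entries are exactly those of the block diagonal matrix.
\<close>

lemma limit_gaussian_matrix_vec:
  fixes P :: "real^'s::finite^'s"
  assumes "limit_gaussian_matrix N W P \<pi>"
  shows "multivariate_normal N (\<lambda>\<omega>. vec_cols (transpose (W \<omega>))) 0 (Sigma_p P \<pi>)"
proof -
  have W: "gaussian N W" "integral\<^sup>L N W = 0"
    and cov: "\<And>i j k l. covariance N (\<lambda>\<omega>. W \<omega> $ i $ j) (\<lambda>\<omega>. W \<omega> $ k $ l)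
        = kdelta i k * inverse (\<pi> $ i) * P $ i $ j * (kdelta j l - P $ i $ l)"
    using assms unfolding limit_gaussian_matrix_def by blast+
  have "integral\<^sup>L N (\<lambda>\<omega>. vec_cols (transpose (W \<omega>))) = vec_cols (transpose (integral\<^sup>L N W))"
    by (rule integral_bounded_linear[OF _ gaussian_integrable[OF W(1)]])
       (simp add: linear_conv_bounded_linear[symmetric] linear_vec_cols_transpose)
  also have "\<dots> = 0" using W(2) by (simp add: vec_eq_iff vec_cols_transpose_nth)
  finally show ?thesis
    unfolding multivariate_normal_def
    using gaussian_linear_image[OF W(1) linear_vec_cols_transpose]
    by (simp add: vec_eq_iff covariance_matrix_def Sigma_p_def Lambda_def vec_cols_transpose_nth cov kdelta_def)
qed

lemma sum_UNIV_pair: "(\<Sum>p\<in>UNIV. f p) = (\<Sum>i\<in>UNIV. \<Sum>j\<in>UNIV. f (i, j))"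
  by (simp add: sum.cartesian_product)

text \<open>
  The rule \<open>vec (A H B) = (B\<^sup>T \<otimes> A) vec H\<close> for stacked rows instead of columns, which exchanges the
  Kronecker factors.
\<close>

lemma vec_cols_transpose_matrix_product:
  fixes A :: "real^'n::finite^'m::finite" and H :: "real^'p::finite^'n" and B :: "real^'q::finite^'p"
  shows "vec_cols (transpose (A ** H ** B)) = kronecker A (transpose B) *v vec_cols (transpose H)"
proof -
  have "(kronecker A (transpose B) *v vec_cols (transpose H)) $ a
      = (\<Sum>k\<in>UNIV. \<Sum>l\<in>UNIV. A $ fst a $ k * B $ l $ snd a * H $ k $ l)" for a :: "'m \<times> 'q"
    by (simp add: matrix_vector_mult_def kronecker_def vec_cols_transpose_nth sum_UNIV_pair
        transpose_def[of B])
  moreover have "(A ** H ** B) $ i $ j = (\<Sum>l\<in>UNIV. \<Sum>k\<in>UNIV. A $ i $ k * B $ l $ j * H $ k $ l)" for i j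
    by (simp add: matrix_matrix_mult_def sum_distrib_right sum_distrib_left mult_ac)
  moreover have "(\<Sum>l\<in>UNIV. \<Sum>k\<in>UNIV. A $ i $ k * B $ l $ j * H $ k $ l)
      = (\<Sum>k\<in>UNIV. \<Sum>l\<in>UNIV. A $ i $ k * B $ l $ j * H $ k $ l)" for i j
    by (rule sum.swap)
  ultimately show ?thesis
    unfolding vec_eq_iff vec_cols_transpose_nth by simp
qed

lemma matrix_vector_mult_linear_left: "linear (\<lambda>A :: real^'n::finite^'m::finite. A *v x)"
  by (rule linearI) (simp_all add: matrix_vector_mult_add_rdistrib scaleR_matrix_vector_assoc)

lemma vec_cols_transpose_matpow_derivative:
  fixes P :: "real^'s::finite^'s"
  shows "vec_cols (transpose (\<Sum>i<k. matpow P i ** H ** matpow P (k - 1 - i)))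
       = M_mat P k *v vec_cols (transpose H)"
proof -
  have "vec_cols (transpose (\<Sum>i<k. matpow P i ** H ** matpow P (k - 1 - i)))
      = (\<Sum>i<k. vec_cols (transpose (matpow P i ** H ** matpow P (k - 1 - i))))"
    by (rule linear_sum[OF linear_vec_cols_transpose])
  then show ?thesis
    unfolding M_mat_def vec_cols_transpose_matrix_product
    by (simp add: linear_sum[OF matrix_vector_mult_linear_left])
qed

lemma inner_matrix_eq_sum_pairs:
  fixes A B :: "real^'n::finite^'m::finite"
  shows "A \<bullet> B = (\<Sum>p\<in>UNIV. A $ fst p $ snd p * B $ fst p $ snd p)"
  by (simp add: inner_vec_def sum_UNIV_pair)

text \<open>
  The exponent is the variance of the linear functional: rows are uncorrelated, and the covariance of
  row \<open>i\<close> is \<open>1 / \<pi> $ i\<close> times that of the indicator vector of one transition out of \<open>i\<close>.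
\<close>

lemma char_limit_gaussian_matrix:
  fixes P :: "real^'s::finite^'s"
  assumes W: "limit_gaussian_matrix N W P \<pi>"
  shows "integral\<^sup>L N (\<lambda>\<omega>. iexp (\<theta> \<bullet> W \<omega>))
       = of_real (exp (- (\<Sum>i\<in>UNIV. inverse (\<pi> $ i) *
           ((\<Sum>j\<in>UNIV. P $ i $ j * (\<theta> $ i $ j)\<^sup>2) - (\<Sum>j\<in>UNIV. P $ i $ j * \<theta> $ i $ j)\<^sup>2)) / 2))"
proof -
  have g: "gaussian N W" "integral\<^sup>L N W = 0"
    and cov: "\<And>i j k l. covariance N (\<lambda>\<omega>. W \<omega> $ i $ j) (\<lambda>\<omega>. W \<omega> $ k $ l)
        = kdelta i k * inverse (\<pi> $ i) * P $ i $ j * (kdelta j l - P $ i $ l)"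
    using W unfolding limit_gaussian_matrix_def by blast+
  have N: "prob_space N" using g unfolding gaussian_def by blast
  have mean: "integral\<^sup>L N (\<lambda>\<omega>. \<theta> \<bullet> W \<omega>) = 0"
    using g(2) gaussian_integrable[OF g(1)] by simp
  have vec: "gaussian N (\<lambda>\<omega>. vec_cols (transpose (W \<omega>)))"
    by (rule gaussian_linear_image[OF g(1) linear_vec_cols_transpose])
  have comp: "(\<lambda>\<omega>. W \<omega> $ fst p $ snd p) \<in> borel_measurable N"
    "integrable N (\<lambda>\<omega>. (W \<omega> $ fst p $ snd p)\<^sup>2)" for p
    using gaussian_component[OF vec, of p] by (simp_all add: vec_cols_transpose_nth)
  have "covariance N (\<lambda>\<omega>. \<theta> \<bullet> W \<omega>) (\<lambda>\<omega>. \<theta> \<bullet> W \<omega>)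
      = (\<Sum>p\<in>UNIV. \<Sum>q\<in>UNIV. \<theta> $ fst p $ snd p * \<theta> $ fst q $ snd q *
          covariance N (\<lambda>\<omega>. W \<omega> $ fst p $ snd p) (\<lambda>\<omega>. W \<omega> $ fst q $ snd q))"
    unfolding inner_matrix_eq_sum_pairs
    by (rule covariance_sum[OF N finite finite]) (use comp in auto)
  also have "\<dots> = (\<Sum>i\<in>UNIV. \<Sum>j\<in>UNIV. \<Sum>k\<in>UNIV. \<Sum>l\<in>UNIV. \<theta> $ i $ j * \<theta> $ k $ l *
      (kdelta i k * inverse (\<pi> $ i) * P $ i $ j * (kdelta j l - P $ i $ l)))"
    by (simp add: cov sum_UNIV_pair)
  also have "\<dots> = (\<Sum>i\<in>UNIV. inverse (\<pi> $ i) *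
           ((\<Sum>j\<in>UNIV. P $ i $ j * (\<theta> $ i $ j)\<^sup>2) - (\<Sum>j\<in>UNIV. P $ i $ j * \<theta> $ i $ j)\<^sup>2))"
  proof (rule sum.cong[OF refl])
    fix i
    have "(\<Sum>k\<in>UNIV. \<Sum>l\<in>UNIV. \<theta> $ i $ j * \<theta> $ k $ l *
        (kdelta i k * inverse (\<pi> $ i) * P $ i $ j * (kdelta j l - P $ i $ l)))
      = inverse (\<pi> $ i) * (P $ i $ j * (\<theta> $ i $ j)\<^sup>2 - (P $ i $ j * \<theta> $ i $ j) * (\<Sum>l\<in>UNIV. P $ i $ l * \<theta> $ i $ l))" for j
    proof -
      have "(\<Sum>k\<in>UNIV. \<Sum>l\<in>UNIV. \<theta> $ i $ j * \<theta> $ k $ l *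
          (kdelta i k * inverse (\<pi> $ i) * P $ i $ j * (kdelta j l - P $ i $ l)))
        = (\<Sum>k\<in>UNIV. if i = k then (\<Sum>l\<in>UNIV. \<theta> $ i $ j * \<theta> $ i $ l *
          (inverse (\<pi> $ i) * P $ i $ j * (kdelta j l - P $ i $ l))) else 0)"
        by (intro sum.cong) (auto simp: kdelta_def)
      also have "\<dots> = (\<Sum>l\<in>UNIV. \<theta> $ i $ j * \<theta> $ i $ l * (inverse (\<pi> $ i) * P $ i $ j * (kdelta j l - P $ i $ l)))"
        by simp
      also have "\<dots> = (\<Sum>l\<in>UNIV. if j = l then inverse (\<pi> $ i) * P $ i $ j * (\<theta> $ i $ j)\<^sup>2 else 0)
          - (\<Sum>l\<in>UNIV. inverse (\<pi> $ i) * (P $ i $ j * \<theta> $ i $ j) * (P $ i $ l * \<theta> $ i $ l))"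
        unfolding sum_subtractf[symmetric]
        by (intro sum.cong) (auto simp: kdelta_def algebra_simps power2_eq_square)
      finally show ?thesis
        by (simp add: sum_distrib_left[symmetric] right_diff_distrib mult.assoc)
    qed
    then show "(\<Sum>j\<in>UNIV. \<Sum>k\<in>UNIV. \<Sum>l\<in>UNIV. \<theta> $ i $ j * \<theta> $ k $ l *
        (kdelta i k * inverse (\<pi> $ i) * P $ i $ j * (kdelta j l - P $ i $ l)))
      = inverse (\<pi> $ i) * ((\<Sum>j\<in>UNIV. P $ i $ j * (\<theta> $ i $ j)\<^sup>2) - (\<Sum>j\<in>UNIV. P $ i $ j * \<theta> $ i $ j)\<^sup>2)"
      by (simp add: sum_distrib_left[symmetric] sum_subtractf sum_distrib_right[symmetric] power2_eq_square)
  qed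
  finally show ?thesis
    using gaussian_inner(3)[OF g(1), of \<theta>] mean by simp
qed

section \<open>The delta method\<close>

text \<open>
  Boundedness at scale \<open>sqrt n\<close> forces consistency.
\<close>

lemma (in prob_space) vanishes_in_prob_of_sqrt_scaled:
  fixes D :: "nat \<Rightarrow> 'a \<Rightarrow> 'v::euclidean_space"
  assumes [measurable]: "\<And>n. D n \<in> borel_measurable M"
    and "bounded_in_prob M (\<lambda>n \<omega>. sqrt (real n) *\<^sub>R D n \<omega>)"
  shows "vanishes_in_prob M D"
proof (rule vanishes_in_prob_small_multiple[where A = "\<lambda>n \<omega>. 1 / sqrt (real n)"
      and Y = "\<lambda>n \<omega>. sqrt (real n) *\<^sub>R D n \<omega>"])
  have "(\<lambda>n. 1 / sqrt (real n)) \<longlonglongrightarrow> 0" by real_asymp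
  then show "vanishes_in_prob M (\<lambda>n \<omega>. 1 / sqrt (real n))"
    by (rule vanishes_in_prob_deterministic)
  fix \<eta> :: real assume "\<eta> > 0"
  moreover have "\<forall>\<^sub>F n in sequentially. \<forall>\<omega>\<in>space M. norm (1 / sqrt (real n)) \<le> \<eta> \<longrightarrow>
      norm (D n \<omega>) \<le> \<eta> * norm (sqrt (real n) *\<^sub>R D n \<omega>)"
    using eventually_gt_at_top[of 0]
  proof eventually_elim
    case (elim n)
    show ?case
    proof (intro ballI impI)
      fix \<omega> assume "norm (1 / sqrt (real n)) \<le> \<eta>"
      then have "1 \<le> \<eta> * sqrt (real n)" using elim by (simp add: field_simps)
      from mult_right_mono[OF this, of "norm (D n \<omega>)"]
      show "norm (D n \<omega>) \<le> \<eta> * norm (sqrt (real n) *\<^sub>R D n \<omega>)" by simp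
    qed
  qed
  ultimately show "\<exists>\<delta>>0. \<forall>\<^sub>F n in sequentially. \<forall>\<omega>\<in>space M. norm (1 / sqrt (real n)) \<le> \<delta> \<longrightarrow>
      norm (D n \<omega>) \<le> \<eta> * norm (sqrt (real n) *\<^sub>R D n \<omega>)" by blast
qed (use assms in auto)

text \<open>
  The remainder of a differentiable function at \<open>x\<close> is a small multiple of \<open>X n - x\<close> as soon as
  \<open>X n\<close> is near \<open>x\<close>; scaling by \<open>sqrt n\<close> preserves the ratio.
\<close>

lemma (in prob_space) delta_method:
  fixes X :: "nat \<Rightarrow> 'a \<Rightarrow> 'v::euclidean_space" and f :: "'v \<Rightarrow> 'w::euclidean_space"
  assumes [measurable]: "\<And>n. X n \<in> borel_measurable M"
    and bounded: "bounded_in_prob M (\<lambda>n \<omega>. sqrt (real n) *\<^sub>R (X n \<omega> - x))"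
    and f: "(f has_derivative f') (at x)"
  shows "vanishes_in_prob M (\<lambda>n \<omega>.
           sqrt (real n) *\<^sub>R (f (X n \<omega>) - f x) - f' (sqrt (real n) *\<^sub>R (X n \<omega> - x)))"
proof (rule vanishes_in_prob_small_multiple[where A = "\<lambda>n \<omega>. X n \<omega> - x"
      and Y = "\<lambda>n \<omega>. sqrt (real n) *\<^sub>R (X n \<omega> - x)"])
  show "vanishes_in_prob M (\<lambda>n \<omega>. X n \<omega> - x)"
    by (rule vanishes_in_prob_of_sqrt_scaled[OF _ bounded]) measurable
  fix \<eta> :: real assume "\<eta> > 0"
  then obtain d where d: "d > 0" "\<And>y. norm (y - x) < d \<Longrightarrow> norm (f y - f x - f' (y - x)) \<le> \<eta> * norm (y - x)"
    using f unfolding has_derivative_at_alt by blast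
  have lin: "linear f'" using f by (rule has_derivative_linear)
  show "\<exists>\<delta>>0. \<forall>\<^sub>F n in sequentially. \<forall>\<omega>\<in>space M. norm (X n \<omega> - x) \<le> \<delta> \<longrightarrow>
      norm (sqrt (real n) *\<^sub>R (f (X n \<omega>) - f x) - f' (sqrt (real n) *\<^sub>R (X n \<omega> - x)))
        \<le> \<eta> * norm (sqrt (real n) *\<^sub>R (X n \<omega> - x))"
  proof (intro exI[of _ "d / 2"] conjI always_eventually allI ballI impI)
    fix n \<omega> assume "norm (X n \<omega> - x) \<le> d / 2"
    then have "norm (X n \<omega> - x) < d" using d(1) by linarith
    from mult_left_mono[OF d(2)[OF this], of "sqrt (real n)"]
    have "norm (sqrt (real n) *\<^sub>R (f (X n \<omega>) - f x - f' (X n \<omega> - x)))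
        \<le> \<eta> * norm (sqrt (real n) *\<^sub>R (X n \<omega> - x))" by (simp add: mult_ac)
    then show "norm (sqrt (real n) *\<^sub>R (f (X n \<omega>) - f x) - f' (sqrt (real n) *\<^sub>R (X n \<omega> - x)))
        \<le> \<eta> * norm (sqrt (real n) *\<^sub>R (X n \<omega> - x))"
      by (simp only: linear_scale[OF lin] scaleR_diff_right[symmetric])
  qed (use d in simp)
qed (use bounded in auto)

lemma (in prob_space) vanishes_in_prob_linear_image:
  fixes R :: "nat \<Rightarrow> 'a \<Rightarrow> 'v::euclidean_space" and f :: "'v \<Rightarrow> 'w::euclidean_space"
  assumes [measurable]: "\<And>n. R n \<in> borel_measurable M"
    and R: "vanishes_in_prob M R" and f: "linear f"
  shows "vanishes_in_prob M (\<lambda>n \<omega>. f (R n \<omega>))"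
proof -
  obtain B where B: "B > 0" "\<And>x. norm (f x) \<le> B * norm x"
    using linear_bounded_pos[OF f] by blast
  show ?thesis
  proof (rule vanishes_in_prob_small_multiple[where A = R and Y = "\<lambda>n \<omega>. 1::real"])
    fix \<eta> :: real assume "\<eta> > 0"
    show "\<exists>\<delta>>0. \<forall>\<^sub>F n in sequentially. \<forall>\<omega>\<in>space M. norm (R n \<omega>) \<le> \<delta> \<longrightarrow>
        norm (f (R n \<omega>)) \<le> \<eta> * norm (1::real)"
    proof (intro exI[of _ "\<eta> / B"] conjI always_eventually allI ballI impI)
      fix n \<omega> assume "norm (R n \<omega>) \<le> \<eta> / B"
      then have "B * norm (R n \<omega>) \<le> \<eta>" using B(1) by (simp add: field_simps)
      then show "norm (f (R n \<omega>)) \<le> \<eta> * norm (1::real)" using B(2)[of "R n \<omega>"] by simp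
    qed (use B \<open>\<eta> > 0\<close> in simp)
  qed (use R bounded_in_prob_const in auto)
qed

section \<open>Invariant vectors of an irreducible stochastic matrix\<close>

lemma invariant_matpow:
  fixes P :: "real^'s::finite^'s"
  assumes "v v* P = v"
  shows "v v* matpow P m = v"
  by (induction m) (simp_all add: vector_matrix_mul_assoc[symmetric] assms)

lemma matpow_nonneg:
  fixes P :: "real^'s::finite^'s"
  assumes "stochastic_matrix P"
  shows "0 \<le> matpow P m $ i $ j"
proof (induction m arbitrary: i)
  case 0
  show ?case by (simp add: mat_def)
next
  case (Suc m)
  then show ?case
    using assms by (auto simp: matrix_matrix_mult_def stochastic_matrix_def intro!: sum_nonneg)
qed

text \<open>
  The mass that an invariant vector puts on \<open>i\<close> is carried to every state by some power of the matrix.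
\<close>

lemma nonneg_invariant_pos:
  fixes P :: "real^'s::finite^'s"
  assumes P: "stochastic_matrix P" "irreducible_matrix P"
    and v: "v v* P = v" "\<And>i. 0 \<le> v $ i" and i: "0 < v $ i"
  shows "0 < v $ j"
proof -
  obtain m where m: "0 < matpow P m $ i $ j" using P(2) unfolding irreducible_matrix_def by blast
  have "0 < matpow P m $ i $ j * v $ i" using m i by simp
  also have "\<dots> \<le> (\<Sum>k\<in>UNIV. matpow P m $ k $ j * v $ k)"
    by (rule member_le_sum) (auto intro!: mult_nonneg_nonneg matpow_nonneg P v)
  also have "\<dots> = (v v* matpow P m) $ j" by (simp add: vector_matrix_mult_def mult.commute)
  also have "\<dots> = v $ j" by (simp add: invariant_matpow[OF v(1)])
  finally show ?thesis .
qed

text \<open>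
  The triangle inequality gives \<open>w \<le> w v* P\<close> for the vector \<open>w\<close> of absolute values. Both sides have the same
  total mass, since the rows of \<open>P\<close> sum to one, so equality holds in every entry.
\<close>

lemma invariant_abs:
  fixes P :: "real^'s::finite^'s"
  assumes P: "stochastic_matrix P" and v: "v v* P = v"
  shows "(\<chi> i. \<bar>v $ i\<bar>) v* P = (\<chi> i. \<bar>v $ i\<bar>)"
proof -
  let ?w = "\<chi> i. \<bar>v $ i\<bar>"
  have le: "?w $ j \<le> (?w v* P) $ j" for j
  proof -
    have "\<bar>v $ j\<bar> = \<bar>\<Sum>i\<in>UNIV. P $ i $ j * v $ i\<bar>"
      using arg_cong[OF v, of "\<lambda>u. u $ j"] by (simp add: vector_matrix_mult_def mult.commute)
    also have "\<dots> \<le> (\<Sum>i\<in>UNIV. \<bar>P $ i $ j * v $ i\<bar>)" by (rule sum_abs)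
    also have "\<dots> = (\<Sum>i\<in>UNIV. P $ i $ j * \<bar>v $ i\<bar>)"
      using P by (simp add: abs_mult stochastic_matrix_def)
    finally show ?thesis by (simp add: vector_matrix_mult_def mult.commute)
  qed
  have "(\<Sum>j\<in>UNIV. (?w v* P) $ j) = (\<Sum>j\<in>UNIV. \<Sum>i\<in>UNIV. P $ i $ j * \<bar>v $ i\<bar>)"
    by (simp add: vector_matrix_mult_def mult.commute)
  also have "\<dots> = (\<Sum>i\<in>UNIV. \<Sum>j\<in>UNIV. P $ i $ j * \<bar>v $ i\<bar>)" by (rule sum.swap)
  also have "\<dots> = (\<Sum>i\<in>UNIV. ?w $ i)"
    using P by (simp add: sum_distrib_right[symmetric] stochastic_matrix_def)
  finally have "(\<Sum>j\<in>UNIV. (?w v* P) $ j - ?w $ j) = 0" by (simp add: sum_subtractf)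
  then have "\<forall>j\<in>UNIV. (?w v* P) $ j - ?w $ j = 0"
    using le by (subst (asm) sum_nonneg_eq_0_iff) auto
  then show ?thesis unfolding vec_eq_iff by simp
qed

text \<open>
  Twice the positive part, the sum of \<open>v\<close> and its absolute value, is a nonnegative invariant vector.
  It does not vanish, so all its entries are positive, which leaves no room for nonpositive entries of \<open>v\<close>.
\<close>

lemma invariant_same_sign:
  fixes P :: "real^'s::finite^'s"
  assumes P: "stochastic_matrix P" "irreducible_matrix P" and v: "v v* P = v" and i: "0 < v $ i"
  shows "0 < v $ j"
proof -
  let ?u = "v + (\<chi> i. \<bar>v $ i\<bar>)"
  have "?u v* P = ?u"
    using invariant_abs[OF P(1) v] v by (simp add: vector_matrix_left_distrib)
  then have "0 < ?u $ j"
    by (rule nonneg_invariant_pos[OF P, where i = i]) (use i in \<open>auto simp: add_pos_pos\<close>)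
  then show ?thesis by (simp add: abs_if split: if_splits)
qed

text \<open>
  Uniqueness of the stationary distribution in linear form: a nonzero invariant vector has entries of
  one strict sign, so its sum cannot vanish.
\<close>

lemma invariant_sum_zero:
  fixes P :: "real^'s::finite^'s"
  assumes P: "stochastic_matrix P" "irreducible_matrix P"
    and v: "v v* P = v" "(\<Sum>i\<in>UNIV. v $ i) = 0"
  shows "v = 0"
proof -
  have no_pos: "\<not> 0 < u $ i" if "u v* P = u" "(\<Sum>i\<in>UNIV. u $ i) = 0" for u i
  proof
    assume "0 < u $ i"
    then have "0 < u $ j" for j by (rule invariant_same_sign[OF P that(1)])
    then have "0 < (\<Sum>i\<in>UNIV. u $ i)" by (intro sum_pos) auto
    then show False using that(2) by simp
  qed
  have "(- v) v* P = - v"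
    using v(1) by (simp add: vector_matrix_mult_def vec_eq_iff sum_negf)
  from no_pos[OF this] v(2) have "0 \<le> v $ i" for i
    by (simp add: sum_negf not_less)
  moreover have "v $ i \<le> 0" for i
    using no_pos[OF v] by (simp add: not_less)
  ultimately show ?thesis
    by (simp add: vec_eq_iff antisym)
qed

lemma stationary_distribution_pos:
  fixes P :: "real^'s::finite^'s"
  assumes P: "stochastic_matrix P" "irreducible_matrix P" and \<pi>: "stationary_distribution P \<pi>"
  shows "0 < \<pi> $ i"
proof -
  have "\<exists>k. 0 < \<pi> $ k"
  proof (rule ccontr)
    assume "\<not> ?thesis"
    then have "(\<Sum>i\<in>UNIV. \<pi> $ i) \<le> 0" by (intro sum_nonpos) (auto simp: not_less)
    then show False using \<pi> unfolding stationary_distribution_def by simp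
  qed
  then obtain k where "0 < \<pi> $ k" ..
  with \<pi> show ?thesis
    using invariant_same_sign[OF P] unfolding stationary_distribution_def by blast
qed

text \<open>
  A vector of total mass one that is almost invariant is close to the stationary distribution. The
  linear map sending \<open>v\<close> to its defect \<open>v v* P - v\<close> together with its total mass is injective by
  uniqueness, hence bounded below, and it sends \<open>v - \<pi>\<close> to the defect of \<open>v\<close> and \<open>0\<close>.
\<close>

lemma distance_to_stationary_distribution:
  fixes P :: "real^'s::finite^'s"
  assumes P: "stochastic_matrix P" "irreducible_matrix P" and \<pi>: "stationary_distribution P \<pi>"
  obtains C where "C > 0"
    "\<And>v. (\<Sum>i\<in>UNIV. v $ i) = 1 \<Longrightarrow> norm (v - \<pi>) \<le> C * norm (v v* P - v)"
proof -
  define f where "f v = (v v* P - v, \<Sum>i\<in>UNIV. v $ i)" for v :: "real^'s"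
  have lin: "linear f"
    unfolding f_def
    by (rule linearI) (simp_all add: vector_matrix_mult_def vec_eq_iff sum.distrib algebra_simps sum_distrib_left)
  have "inj f"
    unfolding linear_injective_0[OF lin] using invariant_sum_zero[OF P] by (simp add: f_def zero_prod_def)
  then obtain B where B: "B > 0" "\<And>v. B * norm v \<le> norm (f v)"
    using linear_inj_bounded_below_pos[OF lin] by blast
  show thesis
  proof (rule that[of "1 / B"])
    fix v :: "real^'s" assume "(\<Sum>i\<in>UNIV. v $ i) = 1"
    moreover have "\<pi> v* P = \<pi>" "(\<Sum>i\<in>UNIV. \<pi> $ i) = 1"
      using \<pi> unfolding stationary_distribution_def by auto
    ultimately have "f (v - \<pi>) = (v v* P - v, 0)"
      unfolding f_def by (simp add: sum_subtractf vector_matrix_mult_diff_distrib)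
    then show "norm (v - \<pi>) \<le> 1 / B * norm (v v* P - v)"
      using B(2)[of "v - \<pi>"] B(1) by (simp add: norm_Pair field_simps)
  qed (use B in simp)
qed

section \<open>Transition counts\<close>

lemma transition_count_eq_sum:
  "real (transition_count x n i j) = (\<Sum>m<n. of_bool (x m = i) * of_bool (x (Suc m) = j))"
proof -
  have "{m. m < n \<and> x m = i \<and> x (Suc m) = j} = {m \<in> {..<n}. x m = i \<and> x (Suc m) = j}" by auto
  then have "real (transition_count x n i j) = (\<Sum>m\<in>{m \<in> {..<n}. x m = i \<and> x (Suc m) = j}. 1)"
    by (simp add: transition_count_def)
  also have "\<dots> = (\<Sum>m<n. if x m = i \<and> x (Suc m) = j then 1 else 0)"
    by (rule sum.inter_filter) simp
  also have "\<dots> = (\<Sum>m<n. of_bool (x m = i) * of_bool (x (Suc m) = j))"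
    by (intro sum.cong) auto
  finally show ?thesis .
qed

lemma visit_count_eq_sum: "real (visit_count x n i) = (\<Sum>m<n. of_bool (x m = i))"
proof -
  have "real (visit_count x n i) = (\<Sum>j\<in>UNIV. \<Sum>m<n. of_bool (x m = i) * of_bool (x (Suc m) = j))"
    by (simp add: visit_count_def transition_count_eq_sum)
  also have "\<dots> = (\<Sum>m<n. \<Sum>j\<in>UNIV. of_bool (x m = i) * of_bool (x (Suc m) = j))" by (rule sum.swap)
  also have "\<dots> = (\<Sum>m<n. of_bool (x m = i))"
    by (simp add: sum_distrib_left[symmetric] of_bool_def)
  finally show ?thesis .
qed

text \<open>
  The deviation of the transition counts from their compensators; every entry is a martingale.
\<close>

definition innovation :: "real^'s^'s \<Rightarrow> (nat \<Rightarrow> 's::finite) \<Rightarrow> nat \<Rightarrow> real^'s^'s" where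
  "innovation P x n = (\<chi> i j. real (transition_count x n i j) - real (visit_count x n i) * P $ i $ j)"

definition visit_frequency :: "(nat \<Rightarrow> 's::finite) \<Rightarrow> nat \<Rightarrow> real^'s" where
  "visit_frequency x n = (\<chi> i. real (visit_count x n i) / real n)"

lemma innovation_nth:
  "innovation P x n $ i $ j
     = additive_functional (\<lambda>k l. of_bool (k = i) * (of_bool (l = j) - P $ i $ j)) n x"
  by (simp only: innovation_def vec_lambda_beta transition_count_eq_sum visit_count_eq_sum
      additive_functional_def sum_distrib_right sum_subtractf right_diff_distrib)

text \<open>
  Every linear functional of the innovation is a centred additive functional, so that one limit theorem
  for scalar functionals covers the whole matrix.
\<close>

lemma inner_innovation:
  "\<theta> \<bullet> innovation P x n
     = additive_functional (\<lambda>i j. \<theta> $ i $ j - (\<Sum>l\<in>UNIV. P $ i $ l * \<theta> $ i $ l)) n x"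
proof -
  have "\<theta> \<bullet> innovation P x n
      = (\<Sum>i\<in>UNIV. \<Sum>j\<in>UNIV. \<Sum>m<n. \<theta> $ i $ j * (of_bool (x m = i) * (of_bool (x (Suc m) = j) - P $ i $ j)))"
    unfolding inner_vec_def innovation_nth additive_functional_def inner_real_def sum_distrib_left ..
  also have "\<dots> = (\<Sum>i\<in>UNIV. \<Sum>m<n. \<Sum>j\<in>UNIV. \<theta> $ i $ j * (of_bool (x m = i) * (of_bool (x (Suc m) = j) - P $ i $ j)))"
    by (intro sum.cong refl sum.swap)
  also have "\<dots> = (\<Sum>m<n. \<Sum>i\<in>UNIV. \<Sum>j\<in>UNIV. \<theta> $ i $ j * (of_bool (x m = i) * (of_bool (x (Suc m) = j) - P $ i $ j)))"
    by (rule sum.swap)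
  also have "\<dots> = (\<Sum>m<n. \<theta> $ x m $ x (Suc m) - (\<Sum>l\<in>UNIV. P $ x m $ l * \<theta> $ x m $ l))"
  proof (rule sum.cong[OF refl])
    fix m
    have row: "(\<Sum>j\<in>UNIV. \<theta> $ i $ j * (of_bool (k = j) - P $ i $ j))
        = \<theta> $ i $ k - (\<Sum>l\<in>UNIV. P $ i $ l * \<theta> $ i $ l)" for i k
    proof -
      have "(\<Sum>j\<in>UNIV. \<theta> $ i $ j * (of_bool (k = j) - P $ i $ j))
          = (\<Sum>j\<in>UNIV. if k = j then \<theta> $ i $ j else 0) - (\<Sum>l\<in>UNIV. P $ i $ l * \<theta> $ i $ l)"
        unfolding sum_subtractf[symmetric] by (intro sum.cong) (auto simp: algebra_simps)
      then show ?thesis by simp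
    qed
    have "(\<Sum>j\<in>UNIV. \<theta> $ i $ j * (of_bool (x m = i) * (of_bool (x (Suc m) = j) - P $ i $ j)))
        = (if x m = i then \<theta> $ i $ x (Suc m) - (\<Sum>l\<in>UNIV. P $ i $ l * \<theta> $ i $ l) else 0)" for i
    proof (cases "x m = i")
      case True
      then show ?thesis using row[of i "x (Suc m)"] by (simp only: of_bool_eq(2) mult_1 simp_thms if_True)
    next
      case False
      then show ?thesis by simp
    qed
    then show "(\<Sum>i\<in>UNIV. \<Sum>j\<in>UNIV. \<theta> $ i $ j * (of_bool (x m = i) * (of_bool (x (Suc m) = j) - P $ i $ j)))
        = \<theta> $ x m $ x (Suc m) - (\<Sum>l\<in>UNIV. P $ x m $ l * \<theta> $ x m $ l)"
      by simp
  qed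
  finally show ?thesis unfolding additive_functional_def .
qed

lemma sum_visits_eq_visit_frequency:
  fixes a :: "'s::finite \<Rightarrow> real"
  shows "(\<Sum>m<n. a (x m)) / real n = (\<Sum>i\<in>UNIV. visit_frequency x n $ i * a i)"
proof -
  have "(\<Sum>i\<in>UNIV. real (visit_count x n i) * a i) = (\<Sum>i\<in>UNIV. \<Sum>m<n. of_bool (x m = i) * a i)"
    by (simp add: visit_count_eq_sum sum_distrib_right)
  also have "\<dots> = (\<Sum>m<n. \<Sum>i\<in>UNIV. of_bool (x m = i) * a i)" by (rule sum.swap)
  also have "\<dots> = (\<Sum>m<n. a (x m))"
    by (simp add: of_bool_def if_distrib[of "\<lambda>u. u * _"] cong: if_cong)
  finally show ?thesis by (simp add: visit_frequency_def sum_divide_distrib[symmetric])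
qed

lemma sum_lessThan_Suc_arg:
  fixes f :: "nat \<Rightarrow> real"
  shows "(\<Sum>m<n. f (Suc m)) = (\<Sum>m<n. f m) + f n - f 0"
  by (induction n) simp_all

text \<open>
  Column \<open>j\<close> of the transition counts adds up to the number of visits to \<open>j\<close> at the times \<open>1, \<dots>, n\<close>,
  which differs from that at the times \<open>0, \<dots>, n - 1\<close> by at most one. Replacing the counts by
  their compensators costs the innovation. So the invariance defect of the visit frequencies is of
  the order of the innovation divided by \<open>n\<close>.
\<close>

lemma visit_frequency_almost_invariant:
  fixes P :: "real^'s::finite^'s"
  assumes n: "n > 0"
  shows "(\<Sum>i\<in>UNIV. visit_frequency x n $ i) = 1"
    and "norm (visit_frequency x n v* P - visit_frequency x n)
       \<le> real CARD('s) * (1 + real CARD('s) * norm (innovation P x n)) / real n"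
proof -
  have "(\<Sum>i\<in>UNIV. visit_frequency x n $ i) = (\<Sum>m<n. 1) / real n"
    using sum_visits_eq_visit_frequency[of "\<lambda>_. 1" x n] by simp
  then show "(\<Sum>i\<in>UNIV. visit_frequency x n $ i) = 1" using n by simp
  have entry: "\<bar>innovation P x n $ i $ j\<bar> \<le> norm (innovation P x n)" for i j
    using component_le_norm_cart[of "innovation P x n $ i" j] Finite_Cartesian_Product.norm_nth_le[of "innovation P x n" i] by linarith
  have "\<bar>(visit_frequency x n v* P - visit_frequency x n) $ j\<bar>
      \<le> (1 + real CARD('s) * norm (innovation P x n)) / real n" for j
  proof -
    have "(\<Sum>i\<in>UNIV. real (transition_count x n i j)) = (\<Sum>i\<in>UNIV. \<Sum>m<n. of_bool (x m = i) * of_bool (x (Suc m) = j))"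
      by (simp add: transition_count_eq_sum)
    also have "\<dots> = (\<Sum>m<n. \<Sum>i\<in>UNIV. of_bool (x m = i) * of_bool (x (Suc m) = j))" by (rule sum.swap)
    also have "\<dots> = (\<Sum>m<n. of_bool (x (Suc m) = j))"
      by (simp add: sum_distrib_right[symmetric] of_bool_def)
    also have "\<dots> = real (visit_count x n j) + of_bool (x n = j) - of_bool (x 0 = j)"
      unfolding visit_count_eq_sum by (rule sum_lessThan_Suc_arg)
    finally have count: "(\<Sum>i\<in>UNIV. real (transition_count x n i j))
        = real (visit_count x n j) + of_bool (x n = j) - of_bool (x 0 = j)" .
    have "(\<Sum>i\<in>UNIV. innovation P x n $ i $ j)
        = (\<Sum>i\<in>UNIV. real (transition_count x n i j)) - (\<Sum>i\<in>UNIV. P $ i $ j * real (visit_count x n i))"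
      by (simp add: innovation_def sum_subtractf mult.commute)
    with count have "(\<Sum>i\<in>UNIV. P $ i $ j * real (visit_count x n i)) - real (visit_count x n j)
        = of_bool (x n = j) - of_bool (x 0 = j) - (\<Sum>i\<in>UNIV. innovation P x n $ i $ j)"
      by linarith
    also have "\<bar>\<dots>\<bar> \<le> 1 + (\<Sum>i\<in>UNIV. \<bar>innovation P x n $ i $ j\<bar>)"
    proof -
      have "\<bar>of_bool a - of_bool b - s\<bar> \<le> 1 + \<bar>s\<bar>" for a b and s :: real by (cases a; cases b) auto
      then show ?thesis by (rule order_trans) (intro add_left_mono sum_abs)
    qed
    also have "\<dots> \<le> 1 + real CARD('s) * norm (innovation P x n)"
      using sum_bounded_above[of UNIV "\<lambda>i. \<bar>innovation P x n $ i $ j\<bar>" "norm (innovation P x n)"] entry by simp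
    finally have "\<bar>(\<Sum>i\<in>UNIV. P $ i $ j * real (visit_count x n i)) - real (visit_count x n j)\<bar> / real n
        \<le> (1 + real CARD('s) * norm (innovation P x n)) / real n"
      by (rule divide_right_mono) simp
    moreover have "(visit_frequency x n v* P - visit_frequency x n) $ j
        = ((\<Sum>i\<in>UNIV. P $ i $ j * real (visit_count x n i)) - real (visit_count x n j)) / real n"
      by (simp add: visit_frequency_def vector_matrix_mult_def sum_divide_distrib diff_divide_distrib
          mult.commute)
    ultimately show ?thesis by simp
  qed
  then have "(\<Sum>j\<in>UNIV. \<bar>(visit_frequency x n v* P - visit_frequency x n) $ j\<bar>)
      \<le> real CARD('s) * ((1 + real CARD('s) * norm (innovation P x n)) / real n)"
    by (intro sum_bounded_above)
  with norm_le_l1_cart[of "visit_frequency x n v* P - visit_frequency x n"]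
  show "norm (visit_frequency x n v* P - visit_frequency x n)
       \<le> real CARD('s) * (1 + real CARD('s) * norm (innovation P x n)) / real n" by simp
qed

section \<open>Law of large numbers and central limit theorem for the estimator\<close>

lemma depends_on_past_transition_count: "depends_on_past n (\<lambda>x :: nat \<Rightarrow> 'b. transition_count x n i j)"
  unfolding depends_on_past_def
proof (intro allI impI)
  fix x y :: "nat \<Rightarrow> 'b" assume "\<forall>l\<le>n. x l = y l"
  then have "{m. m < n \<and> x m = i \<and> x (Suc m) = j} = {m. m < n \<and> y m = i \<and> y (Suc m) = j}" by auto
  then show "transition_count x n i j = transition_count y n i j" by (simp add: transition_count_def)
qed

text \<open>
  All statistics below are functions of the transition counts and measurable for this reason.
\<close>

lemma depends_on_past_counts:
  fixes F :: "(nat \<Rightarrow> 's) \<Rightarrow> 'b"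
  assumes "\<And>x y. (\<And>i j. transition_count x n i j = transition_count y n i j) \<Longrightarrow> F x = F y"
  shows "depends_on_past n F"
  unfolding depends_on_past_def
proof (intro allI impI assms)
  fix x y :: "nat \<Rightarrow> 's" and i j assume "\<forall>l\<le>n. x l = y l"
  then show "transition_count x n i j = transition_count y n i j"
    using depends_on_past_transition_count[of n i j] unfolding depends_on_past_def by blast
qed

lemma norm_matrix_le_componentwise:
  fixes A B :: "real^'n::finite^'m::finite"
  assumes "\<And>i j. \<bar>A $ i $ j\<bar> \<le> c * \<bar>B $ i $ j\<bar>" "0 \<le> c"
  shows "norm A \<le> c * norm B"
proof -
  have "norm A \<le> norm (c *\<^sub>R B)"
    by (intro norm_le_componentwise_cart) (use assms in \<open>simp add: abs_mult\<close>)
  then show ?thesis using assms(2) by simp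
qed

text \<open>
  The first bound keeps \<open>u\<close> above \<open>c / 2\<close>, so that the denominator \<open>u * p\<close> is at least \<open>c * c / 2\<close>; the second
  bound is \<open>\<eta>\<close> times that.
\<close>

lemma inverse_close:
  fixes u p c \<eta> :: real
  assumes "c > 0" "c \<le> p" "\<eta> > 0" "\<bar>u - p\<bar> \<le> min (c / 2) (\<eta> * c * c / 2)"
  shows "u > 0" "\<bar>1 / u - 1 / p\<bar> \<le> \<eta>"
proof -
  have u: "u \<ge> c / 2" using assms by linarith
  then show "u > 0" using assms by linarith
  then have "\<bar>1 / u - 1 / p\<bar> = \<bar>u - p\<bar> / (u * p)"
    using assms by (simp add: field_simps abs_if)
  also have "\<dots> \<le> (\<eta> * c * c / 2) / (c / 2 * c)"
    using assms u by (intro frac_le mult_mono) auto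
  also have "\<dots> = \<eta>" using assms by simp
  finally show "\<bar>1 / u - 1 / p\<bar> \<le> \<eta>" .
qed

locale irreducible_chain = finite_markov_chain M X P
  for M :: "'a measure" and X :: "nat \<Rightarrow> 'a \<Rightarrow> 's::finite" and P :: "real^'s^'s" +
  fixes \<pi> :: "real^'s"
  assumes irreducible: "irreducible_matrix P" and stationary: "stationary_distribution P \<pi>"
begin

lemma stochastic: "stochastic_matrix P"
  using markov unfolding markov_chain_def by blast

lemmas \<pi>_pos = stationary_distribution_pos[OF stochastic irreducible stationary]

lemma innovation_measurable[measurable]: "(\<lambda>\<omega>. innovation P (trajectory \<omega>) n) \<in> borel_measurable M"
  by (rule borel_measurable_past, rule depends_on_past_counts[where n = n]) (simp add: innovation_def visit_count_def)

lemma P_hat_measurable[measurable]: "(\<lambda>\<omega>. P_hat (trajectory \<omega>) n) \<in> borel_measurable M"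
proof (rule borel_measurable_past, rule depends_on_past_counts)
  fix x y :: "nat \<Rightarrow> 's"
  assume eq: "\<And>i j. transition_count x n i j = transition_count y n i j"
  show "P_hat x n = P_hat y n" unfolding P_hat_def visit_count_def eq ..
qed

lemma visit_frequency_measurable[measurable]:
  "(\<lambda>\<omega>. visit_frequency (trajectory \<omega>) n) \<in> borel_measurable M"
  by (rule borel_measurable_past, rule depends_on_past_counts[where n = n]) (simp add: visit_frequency_def visit_count_def)

lemma P_le_1: "P $ i $ j \<le> 1"
  using member_le_sum[of j UNIV "\<lambda>j. P $ i $ j"] P_sum[of i] P_nonneg by simp

text \<open>
  The squared norm is the sum of the squared entries, and every entry of the innovation, a martingale
  with increments bounded by one, has second moment at most \<open>n\<close>.
\<close>

lemma scaled_innovation_bounded_in_prob: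
  "bounded_in_prob M (\<lambda>n \<omega>. innovation P (trajectory \<omega>) n /\<^sub>R sqrt (real n))"
proof -
  define g :: "'s \<Rightarrow> 's \<Rightarrow> 's \<Rightarrow> 's \<Rightarrow> real"
    where "g i j k l = of_bool (k = i) * (of_bool (l = j) - P $ i $ j)" for i j k l
  have centred: "(\<Sum>l\<in>UNIV. P $ k $ l * g i j k l) = 0" for i j k
  proof (cases "k = i")
    case True
    have "(\<Sum>l\<in>UNIV. P $ k $ l * g i j k l)
        = (\<Sum>l\<in>UNIV. (if l = j then P $ i $ l else 0) - P $ i $ j * P $ i $ l)"
      unfolding g_def True by (intro sum.cong) (auto simp: algebra_simps)
    also have "\<dots> = 0" unfolding sum_subtractf sum_distrib_left[symmetric] P_sum by simp
    finally show ?thesis .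
  qed (simp add: g_def)
  have g_le: "\<bar>g i j k l\<bar> \<le> 1" for i j k l
    unfolding g_def using P_nonneg[of i j] P_le_1[of i j] by (auto simp: of_bool_def)
  have second: "expectation (\<lambda>\<omega>. (innovation P (trajectory \<omega>) n $ i $ j)\<^sup>2) \<le> real n" for n i j
    using second_moment_centred_additive_functional[of "g i j" 1 n, OF centred g_le]
    unfolding innovation_nth g_def[abs_def] by simp
  have norm2: "(norm (A :: real^'s^'s))\<^sup>2 = (\<Sum>i\<in>UNIV. \<Sum>j\<in>UNIV. (A $ i $ j)\<^sup>2)" for A
    unfolding power2_norm_eq_inner unfolding inner_vec_def inner_real_def power2_eq_square ..
  have int: "integrable M (\<lambda>\<omega>. (innovation P (trajectory \<omega>) n $ i $ j)\<^sup>2)" for n i j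
    unfolding innovation_nth
    by (rule integrable_past[OF depends_on_past_comp[OF depends_on_past_additive_functional]])
  have "bounded_in_prob M (\<lambda>n \<omega>. norm (innovation P (trajectory \<omega>) n /\<^sub>R sqrt (real n)))"
  proof (rule bounded_second_moment_imp_bounded_in_prob[where C = "real CARD('s) * real CARD('s)"])
    fix n
    have eq: "(norm (innovation P (trajectory \<omega>) n /\<^sub>R sqrt (real n)))\<^sup>2
        = (\<Sum>i\<in>UNIV. \<Sum>j\<in>UNIV. (innovation P (trajectory \<omega>) n $ i $ j)\<^sup>2 / real n)" for \<omega>
      unfolding norm2 by (simp add: power_mult_distrib power_inverse divide_inverse mult.commute)
    show "integrable M (\<lambda>\<omega>. (norm (innovation P (trajectory \<omega>) n /\<^sub>R sqrt (real n)))\<^sup>2)"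
      unfolding eq by (intro Bochner_Integration.integrable_sum integrable_divide int)
    have "expectation (\<lambda>\<omega>. (norm (innovation P (trajectory \<omega>) n /\<^sub>R sqrt (real n)))\<^sup>2)
        = (\<Sum>i\<in>UNIV. \<Sum>j\<in>UNIV. expectation (\<lambda>\<omega>. (innovation P (trajectory \<omega>) n $ i $ j)\<^sup>2) / real n)"
      unfolding eq
      by (subst Bochner_Integration.integral_sum, intro Bochner_Integration.integrable_sum integrable_divide int,
          intro sum.cong refl, subst Bochner_Integration.integral_sum, intro integrable_divide int,
          simp)
    also have "\<dots> \<le> (\<Sum>i\<in>(UNIV::'s set). \<Sum>j\<in>(UNIV::'s set). 1)"
      using second[of n] by (intro sum_mono) (cases "n = 0"; simp)
    finally show "expectation (\<lambda>\<omega>. (norm (innovation P (trajectory \<omega>) n /\<^sub>R sqrt (real n)))\<^sup>2)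
        \<le> real CARD('s) * real CARD('s)" by simp
  qed measurable
  then show ?thesis unfolding bounded_in_prob_def by simp
qed

text \<open>
  The innovation is of order \<open>sqrt n\<close>, so the visit frequencies are invariant up to
  \<open>O (1 / sqrt n)\<close>, hence close to the stationary distribution.
\<close>

theorem visit_frequency_lln: "vanishes_in_prob M (\<lambda>n \<omega>. visit_frequency (trajectory \<omega>) n - \<pi>)"
proof -
  obtain C where C: "C > 0"
    "\<And>v. (\<Sum>i\<in>UNIV. v $ i) = 1 \<Longrightarrow> norm (v - \<pi>) \<le> C * norm (v v* P - v)"
    using distance_to_stationary_distribution[OF stochastic irreducible stationary] by blast
  define s where "s = real CARD('s)"
  have s: "s \<ge> 1" unfolding s_def using zero_less_card_finite[where 'a = 's] by linarith
  define T where "T n \<omega> = innovation P (trajectory \<omega>) n /\<^sub>R sqrt (real n)" for n \<omega>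
  have [measurable]: "T n \<in> borel_measurable M" for n unfolding T_def by measurable
  have bound: "norm (visit_frequency (trajectory \<omega>) n - \<pi>) \<le> C * s * s / sqrt (real n) * (1 + norm (T n \<omega>))"
    if n: "n > 0" for n \<omega>
  proof -
    have sq: "1 \<le> sqrt (real n)" "sqrt (real n) * sqrt (real n) = real n" using n by auto
    have norm_innov: "norm (innovation P (trajectory \<omega>) n) = sqrt (real n) * norm (T n \<omega>)"
      unfolding T_def using sq by simp
    have "norm (visit_frequency (trajectory \<omega>) n - \<pi>)
        \<le> C * (s * (1 + s * norm (innovation P (trajectory \<omega>) n)) / real n)"
      using C(2)[OF visit_frequency_almost_invariant(1)[OF n, of "trajectory \<omega>"]]
        mult_left_mono[OF visit_frequency_almost_invariant(2)[OF n, of "trajectory \<omega>" P], of C] C(1)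
      unfolding s_def by linarith
    also have "1 + s * norm (innovation P (trajectory \<omega>) n) \<le> s * sqrt (real n) * (1 + norm (T n \<omega>))"
    proof -
      have "1 * 1 \<le> s * sqrt (real n)" by (intro mult_mono) (use s sq in auto)
      then show ?thesis unfolding norm_innov by (simp add: algebra_simps)
    qed
    then have "C * (s * (1 + s * norm (innovation P (trajectory \<omega>) n)) / real n)
        \<le> C * (s * (s * sqrt (real n) * (1 + norm (T n \<omega>))) / real n)"
      using C(1) s by (intro mult_left_mono divide_right_mono) auto
    also have "\<dots> = C * s * s / sqrt (real n) * (1 + norm (T n \<omega>))"
    proof -
      have "C * (s * (s * sqrt (real n) * (1 + norm (T n \<omega>))) / real n)
          = C * s * s * (1 + norm (T n \<omega>)) * (sqrt (real n) / real n)" by simp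
      also have "sqrt (real n) / real n = 1 / sqrt (real n)"
        using n by (simp add: frac_eq_eq)
      finally show ?thesis by simp
    qed
    finally show ?thesis .
  qed
  show ?thesis
  proof (rule vanishes_in_prob_small_multiple[where A = "\<lambda>n \<omega>. 1 / sqrt (real n)" and Y = "\<lambda>n \<omega>. 1 + norm (T n \<omega>)"])
    have "(\<lambda>n. 1 / sqrt (real n)) \<longlonglongrightarrow> 0" by real_asymp
    then show "vanishes_in_prob M (\<lambda>n \<omega>. 1 / sqrt (real n))"
      by (rule vanishes_in_prob_deterministic)
    have "bounded_in_prob M (\<lambda>n \<omega>. norm (T n \<omega>))"
      using scaled_innovation_bounded_in_prob unfolding bounded_in_prob_def T_def by simp
    then show "bounded_in_prob M (\<lambda>n \<omega>. 1 + norm (T n \<omega>))"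
      by (intro bounded_in_prob_add bounded_in_prob_const) measurable
    fix \<eta> :: real assume \<eta>: "\<eta> > 0"
    have "\<forall>\<^sub>F n in sequentially. \<forall>\<omega>\<in>space M. norm (1 / sqrt (real n)) \<le> \<eta> / (C * s * s) \<longrightarrow>
        norm (visit_frequency (trajectory \<omega>) n - \<pi>) \<le> \<eta> * norm (1 + norm (T n \<omega>))"
      using eventually_gt_at_top[of 0]
    proof eventually_elim
      case (elim n)
      show ?case
      proof (intro ballI impI)
        fix \<omega> assume "norm (1 / sqrt (real n)) \<le> \<eta> / (C * s * s)"
        then have "C * s * s / sqrt (real n) \<le> \<eta>"
          using C(1) s elim by (simp add: field_simps)
        from mult_right_mono[OF this, of "1 + norm (T n \<omega>)"] bound[OF elim, of \<omega>]
        show "norm (visit_frequency (trajectory \<omega>) n - \<pi>) \<le> \<eta> * norm (1 + norm (T n \<omega>))"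
          by (simp add: abs_of_nonneg)
      qed
    qed
    then show "\<exists>\<delta>>0. \<forall>\<^sub>F n in sequentially. \<forall>\<omega>\<in>space M. norm (1 / sqrt (real n)) \<le> \<delta> \<longrightarrow>
        norm (visit_frequency (trajectory \<omega>) n - \<pi>) \<le> \<eta> * norm (1 + norm (T n \<omega>))"
      using \<eta> C(1) s by (intro exI[of _ "\<eta> / (C * s * s)"]) auto
  qed measurable
qed

definition scaled_innovation :: "nat \<Rightarrow> 'a \<Rightarrow> real^'s^'s" where
  "scaled_innovation n \<omega> = innovation P (trajectory \<omega>) n /\<^sub>R sqrt (real n)"

text \<open>
  What remains of \<open>sqrt n * (P_hat - P)\<close> when the random denominators are replaced by their limits.
\<close>

definition leading_term :: "nat \<Rightarrow> 'a \<Rightarrow> real^'s^'s" where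
  "leading_term n \<omega> = (\<chi> i j. scaled_innovation n \<omega> $ i $ j / \<pi> $ i)"

lemma scaled_innovation_measurable[measurable]: "scaled_innovation n \<in> borel_measurable M"
  unfolding scaled_innovation_def by measurable

lemma linear_divide_rows: "linear (\<lambda>A :: real^'s^'s. \<chi> i j. A $ i $ j / \<pi> $ i)"
  by (rule linearI) (simp_all add: vec_eq_iff add_divide_distrib)

lemma leading_term_measurable[measurable]: "leading_term n \<in> borel_measurable M"
proof -
  have "(\<lambda>A :: real^'s^'s. \<chi> i j. A $ i $ j / \<pi> $ i) \<in> borel_measurable borel"
    by (rule borel_measurable_continuous_onI, rule linear_continuous_on)
       (use linear_divide_rows in \<open>simp add: linear_conv_bounded_linear\<close>)
  from measurable_compose[OF scaled_innovation_measurable this] show ?thesis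
    unfolding leading_term_def .
qed

lemma \<pi>_bounded_below: obtains c where "c > 0" "\<And>i. c \<le> \<pi> $ i"
proof
  show "Min (range (($) \<pi>)) > 0" using \<pi>_pos by (subst Min_gr_iff) auto
  show "Min (range (($) \<pi>)) \<le> \<pi> $ i" for i by (rule Min_le) auto
qed

lemma leading_term_bounded_in_prob: "bounded_in_prob M leading_term"
proof -
  obtain c where c: "c > 0" "\<And>i. c \<le> \<pi> $ i" using \<pi>_bounded_below by blast
  show ?thesis
  proof (rule bounded_in_prob_mono[where Y = scaled_innovation and C = "1 / c"])
    show "bounded_in_prob M scaled_innovation"
      using scaled_innovation_bounded_in_prob unfolding scaled_innovation_def .
    fix n \<omega>
    show "norm (leading_term n \<omega>) \<le> 1 / c * norm (scaled_innovation n \<omega>)"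
    proof (rule norm_matrix_le_componentwise)
      fix i j
      have "\<bar>scaled_innovation n \<omega> $ i $ j\<bar> / \<pi> $ i \<le> \<bar>scaled_innovation n \<omega> $ i $ j\<bar> / c"
        using c(1) c(2)[of i] by (intro divide_left_mono) auto
      then show "\<bar>leading_term n \<omega> $ i $ j\<bar> \<le> 1 / c * \<bar>scaled_innovation n \<omega> $ i $ j\<bar>"
        using \<pi>_pos[of i] by (simp add: leading_term_def abs_divide)
    qed (use c in simp)
  qed (use c in simp_all)
qed

text \<open>
  Row \<open>i\<close> of the estimation error is the innovation divided by the number of visits to \<open>i\<close>. Its
  difference to the leading term is the scaled innovation times the difference of the inverses
  of visit frequency and stationary probability, which is small by the law of large numbers.
\<close>

theorem estimator_expansion:
  "vanishes_in_prob M (\<lambda>n \<omega>. sqrt (real n) *\<^sub>R (P_hat (trajectory \<omega>) n - P) - leading_term n \<omega>)"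
proof (rule vanishes_in_prob_small_multiple[where A = "\<lambda>n \<omega>. visit_frequency (trajectory \<omega>) n - \<pi>"
      and Y = scaled_innovation])
  show "vanishes_in_prob M (\<lambda>n \<omega>. visit_frequency (trajectory \<omega>) n - \<pi>)" by (rule visit_frequency_lln)
  show "bounded_in_prob M scaled_innovation"
    using scaled_innovation_bounded_in_prob unfolding scaled_innovation_def .
  fix \<eta> :: real assume \<eta>: "\<eta> > 0"
  obtain c where c: "c > 0" "\<And>i. c \<le> \<pi> $ i" using \<pi>_bounded_below by blast
  \<comment> \<open>This radius keeps every visit frequency positive and its inverse within \<open>\<eta>\<close> of that of \<open>\<pi>\<close>.\<close>
  define \<delta> where "\<delta> = min (c / 2) (\<eta> * c * c / 2)"
  have "\<delta> > 0" unfolding \<delta>_def using c \<eta> by simp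
  moreover have "\<forall>\<^sub>F n in sequentially. \<forall>\<omega>\<in>space M. norm (visit_frequency (trajectory \<omega>) n - \<pi>) \<le> \<delta> \<longrightarrow>
      norm (sqrt (real n) *\<^sub>R (P_hat (trajectory \<omega>) n - P) - leading_term n \<omega>)
        \<le> \<eta> * norm (scaled_innovation n \<omega>)"
    using eventually_gt_at_top[of 0]
  proof eventually_elim
    case (elim n)
    show ?case
    proof (intro ballI impI)
      fix \<omega> assume close: "norm (visit_frequency (trajectory \<omega>) n - \<pi>) \<le> \<delta>"
      let ?\<nu> = "visit_frequency (trajectory \<omega>) n"
      let ?R = "sqrt (real n) *\<^sub>R (P_hat (trajectory \<omega>) n - P) - leading_term n \<omega>"
      show "norm ?R \<le> \<eta> * norm (scaled_innovation n \<omega>)"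
      proof (rule norm_matrix_le_componentwise)
        fix i j
        have "\<bar>?\<nu> $ i - \<pi> $ i\<bar> \<le> \<delta>"
          using component_le_norm_cart[of "?\<nu> - \<pi>" i] close by simp
        from inverse_close[OF c(1) c(2) \<eta> this[unfolded \<delta>_def]]
        have \<nu>: "?\<nu> $ i > 0" "\<bar>1 / ?\<nu> $ i - 1 / \<pi> $ i\<bar> \<le> \<eta>" .
        let ?N = "real (visit_count (trajectory \<omega>) n i)" and ?N' = "real (transition_count (trajectory \<omega>) n i j)"
        have N: "?N > 0" using \<nu>(1) elim by (simp add: visit_frequency_def zero_less_divide_iff)
        have "sqrt (real n) * (?N' / ?N - P $ i $ j) = sqrt (real n) * ((?N' - ?N * P $ i $ j) / ?N)"
          using N by (simp add: field_simps)
        also have "\<dots> = real n / sqrt (real n) * ((?N' - ?N * P $ i $ j) / ?N)"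
          by (simp add: real_div_sqrt)
        also have "\<dots> = (?N' - ?N * P $ i $ j) / sqrt (real n) * (real n / ?N)"
          by simp
        finally have "sqrt (real n) * (P_hat (trajectory \<omega>) n $ i $ j - P $ i $ j)
            = scaled_innovation n \<omega> $ i $ j * (1 / ?\<nu> $ i)"
          using N by (simp add: P_hat_def scaled_innovation_def innovation_def visit_frequency_def divide_inverse)
        then have "?R $ i $ j = scaled_innovation n \<omega> $ i $ j * (1 / ?\<nu> $ i - 1 / \<pi> $ i)"
          by (simp add: leading_term_def right_diff_distrib)
        then show "\<bar>?R $ i $ j\<bar> \<le> \<eta> * \<bar>scaled_innovation n \<omega> $ i $ j\<bar>"
          using mult_left_mono[OF \<nu>(2), of "\<bar>scaled_innovation n \<omega> $ i $ j\<bar>"] by (simp add: abs_mult mult.commute)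
      qed (use \<eta> in simp)
    qed
  qed
  ultimately show "\<exists>\<delta>>0. \<forall>\<^sub>F n in sequentially. \<forall>\<omega>\<in>space M. norm (visit_frequency (trajectory \<omega>) n - \<pi>) \<le> \<delta> \<longrightarrow>
      norm (sqrt (real n) *\<^sub>R (P_hat (trajectory \<omega>) n - P) - leading_term n \<omega>)
        \<le> \<eta> * norm (scaled_innovation n \<omega>)" by blast
qed measurable

text \<open>
  A linear functional of the leading term is a scaled centred additive functional. Its asymptotic
  variance \<open>\<Sum>i. \<pi> $ i * a i\<close> contains the factor \<open>(1 / \<pi> $ i)\<^sup>2\<close> from the normalization and the
  factor \<open>\<pi> $ i\<close> from the visit frequency, which leaves \<open>1 / \<pi> $ i\<close>.
\<close>

lemma leading_term_char:
  "(\<lambda>n. expectation (\<lambda>\<omega>. iexp (\<theta> \<bullet> leading_term n \<omega>)))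
     \<longlonglongrightarrow> of_real (exp (- (\<Sum>i\<in>UNIV. inverse (\<pi> $ i) *
           ((\<Sum>j\<in>UNIV. P $ i $ j * (\<theta> $ i $ j)\<^sup>2) - (\<Sum>j\<in>UNIV. P $ i $ j * \<theta> $ i $ j)\<^sup>2)) / 2))"
proof -
  \<comment> \<open>Dividing the rows of \<open>\<theta>\<close> instead of those of the leading term leaves a functional of the innovation.\<close>
  define \<theta>' :: "real^'s^'s" where "\<theta>' = (\<chi> i j. \<theta> $ i $ j / \<pi> $ i)"
  define m where "m i = (\<Sum>l\<in>UNIV. P $ i $ l * \<theta>' $ i $ l)" for i
  define g where "g i j = \<theta>' $ i $ j - m i" for i j
  define a where "a i = (\<Sum>j\<in>UNIV. P $ i $ j * (g i j)\<^sup>2)" for i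
  have inner: "\<theta> \<bullet> leading_term n \<omega> = additive_functional g n (trajectory \<omega>) / sqrt (real n)" for n \<omega>
  proof -
    have "\<theta> \<bullet> leading_term n \<omega> = (\<theta>' \<bullet> innovation P (trajectory \<omega>) n) / sqrt (real n)"
      by (simp add: inner_vec_def leading_term_def scaled_innovation_def \<theta>'_def sum_distrib_left divide_inverse mult_ac)
    then show ?thesis unfolding inner_innovation g_def m_def by simp
  qed
  have centred: "(\<Sum>j\<in>UNIV. P $ i $ j * g i j) = 0" for i
    unfolding g_def right_diff_distrib sum_subtractf sum_distrib_right[symmetric] P_sum by (simp add: m_def)
  have a_eq: "\<pi> $ i * a i = inverse (\<pi> $ i) *
      ((\<Sum>j\<in>UNIV. P $ i $ j * (\<theta> $ i $ j)\<^sup>2) - (\<Sum>j\<in>UNIV. P $ i $ j * \<theta> $ i $ j)\<^sup>2)" for i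
  proof -
    have "a i = (\<Sum>j\<in>UNIV. P $ i $ j * (\<theta>' $ i $ j)\<^sup>2) - 2 * m i * (\<Sum>j\<in>UNIV. P $ i $ j * \<theta>' $ i $ j)
        + (\<Sum>j\<in>UNIV. P $ i $ j) * (m i)\<^sup>2"
      unfolding a_def g_def power2_diff
      by (simp add: algebra_simps sum.distrib sum_subtractf sum_distrib_left sum_distrib_right)
    then have "a i = (\<Sum>j\<in>UNIV. P $ i $ j * (\<theta>' $ i $ j)\<^sup>2) - (m i)\<^sup>2"
      unfolding P_sum m_def[symmetric] by (simp add: power2_eq_square)
    moreover have "(\<Sum>j\<in>UNIV. P $ i $ j * (\<theta>' $ i $ j)\<^sup>2) = (\<Sum>j\<in>UNIV. P $ i $ j * (\<theta> $ i $ j)\<^sup>2) / (\<pi> $ i)\<^sup>2"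
      by (simp add: \<theta>'_def power_divide sum_divide_distrib)
    moreover have "m i = (\<Sum>j\<in>UNIV. P $ i $ j * \<theta> $ i $ j) / \<pi> $ i"
      by (simp add: m_def \<theta>'_def sum_divide_distrib)
    ultimately show ?thesis
      using \<pi>_pos[of i] by (simp add: power_divide field_simps power2_eq_square)
  qed
  have "linear (\<lambda>w :: real^'s. \<Sum>i\<in>UNIV. w $ i * a i)"
    by (rule linearI) (simp_all add: sum.distrib sum_distrib_left algebra_simps)
  from vanishes_in_prob_linear_image[OF _ visit_frequency_lln this]
  have "vanishes_in_prob M (\<lambda>n \<omega>. \<Sum>i\<in>UNIV. (visit_frequency (trajectory \<omega>) n - \<pi>) $ i * a i)"
    by measurable
  then have "vanishes_in_prob M (\<lambda>n \<omega>. (\<Sum>l<n. a (X l \<omega>)) / real n - (\<Sum>i\<in>UNIV. \<pi> $ i * a i))"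
    using sum_visits_eq_visit_frequency[of a "trajectory _"]
    by (simp add: left_diff_distrib sum_subtractf)
  from additive_functional_clt[OF centred a_def this]
  show ?thesis unfolding inner a_eq .
qed

text \<open>
  The error of \<open>f\<close> at the estimator is \<open>f'\<close> of the leading term up to two vanishing remainders: one from
  linearizing \<open>f\<close>, one from linearizing the estimator itself. The characteristic functions of \<open>f'\<close>
  of the leading term converge because those of the leading term do, by passing to the adjoint.
\<close>

theorem differentiable_function_of_estimator_clt:
  fixes f :: "real^'s^'s \<Rightarrow> 'w::euclidean_space"
  assumes W: "limit_gaussian_matrix N W P \<pi>"
    and f: "(f has_derivative f') (at P)" and [measurable]: "f \<in> borel_measurable borel"
  shows "converges_in_distribution M
           (\<lambda>n \<omega>. sqrt (real n) *\<^sub>R (f (P_hat (trajectory \<omega>) n) - f P)) N (\<lambda>\<omega>. f' (W \<omega>))"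
proof (rule converges_in_distribution_of_char_perturbed[where Y = "\<lambda>n \<omega>. f' (leading_term n \<omega>)"])
  have g: "gaussian N W" using W unfolding limit_gaussian_matrix_def by blast
  then show "prob_space N" unfolding gaussian_def by blast
  have lin: "linear f'" using f by (rule has_derivative_linear)
  then have f'_meas[measurable]: "f' \<in> borel_measurable borel"
    by (intro borel_measurable_continuous_onI linear_continuous_on) (simp add: linear_conv_bounded_linear)
  have W_meas: "W \<in> borel_measurable N" using g unfolding gaussian_def by blast
  then show "(\<lambda>\<omega>. f' (W \<omega>)) \<in> borel_measurable N" by measurable
  show "prob_space M" by (rule prob_space_axioms)
  show "(\<lambda>\<omega>. f' (leading_term n \<omega>)) \<in> borel_measurable M" for n by measurable
  show "(\<lambda>\<omega>. sqrt (real n) *\<^sub>R (f (P_hat (trajectory \<omega>) n) - f P)) \<in> borel_measurable M" for n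
    by measurable
  show "bounded_in_prob M (\<lambda>n \<omega>. f' (leading_term n \<omega>))"
  proof -
    obtain B where "B > 0" "\<And>x. norm (f' x) \<le> B * norm x" using linear_bounded_pos[OF lin] by blast
    then show ?thesis
      by (intro bounded_in_prob_mono[OF leading_term_measurable leading_term_bounded_in_prob])
  qed
  have adj: "\<theta> \<bullet> f' x = adjoint f' \<theta> \<bullet> x" for \<theta> x by (simp add: adjoint_clauses[OF lin])
  show "(\<lambda>n. expectation (\<lambda>\<omega>. iexp (\<theta> \<bullet> f' (leading_term n \<omega>)))) \<longlonglongrightarrow> integral\<^sup>L N (\<lambda>\<omega>. iexp (\<theta> \<bullet> f' (W \<omega>)))" for \<theta>
    unfolding adj char_limit_gaussian_matrix[OF W] by (rule leading_term_char)
  let ?\<Delta> = "\<lambda>n \<omega>. sqrt (real n) *\<^sub>R (P_hat (trajectory \<omega>) n - P)"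
  have "bounded_in_prob M (\<lambda>n \<omega>. leading_term n \<omega> + (?\<Delta> n \<omega> - leading_term n \<omega>))"
    by (intro bounded_in_prob_add leading_term_bounded_in_prob
        vanishes_imp_bounded_in_prob estimator_expansion) measurable
  then have "bounded_in_prob M ?\<Delta>" by simp
  then have "vanishes_in_prob M (\<lambda>n \<omega>. sqrt (real n) *\<^sub>R (f (P_hat (trajectory \<omega>) n) - f P) - f' (?\<Delta> n \<omega>))"
    using f by (intro delta_method) measurable
  moreover have "vanishes_in_prob M (\<lambda>n \<omega>. f' (?\<Delta> n \<omega> - leading_term n \<omega>))"
    by (intro vanishes_in_prob_linear_image[OF _ estimator_expansion lin]) measurable
  ultimately have "vanishes_in_prob M (\<lambda>n \<omega>.
      (sqrt (real n) *\<^sub>R (f (P_hat (trajectory \<omega>) n) - f P) - f' (?\<Delta> n \<omega>)) + f' (?\<Delta> n \<omega> - leading_term n \<omega>))"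
    by (intro vanishes_in_prob_add) measurable
  moreover have "(sqrt (real n) *\<^sub>R (f (P_hat (trajectory \<omega>) n) - f P) - f' (?\<Delta> n \<omega>)) + f' (?\<Delta> n \<omega> - leading_term n \<omega>)
      = sqrt (real n) *\<^sub>R (f (P_hat (trajectory \<omega>) n) - f P) - f' (leading_term n \<omega>)" for n \<omega>
    by (simp only: linear_diff[OF lin]) simp
  ultimately show "vanishes_in_prob M (\<lambda>n \<omega>.
      sqrt (real n) *\<^sub>R (f (P_hat (trajectory \<omega>) n) - f P) - f' (leading_term n \<omega>))" by simp
qed

end

section \<open>Powers of the estimator\<close>

theorem proposition4:
  fixes P :: "real^'s::finite^'s" and k :: nat
  assumes k: "k \<ge> 1"
    and stochastic: "stochastic_matrix P"
    and irreducible: "irreducible_matrix P"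
  shows
    "(\<forall>A :: real^'s^'s. (\<lambda>B. matpow B k) differentiable (at A)) \<and>
     ((\<lambda>B. matpow B k) has_derivative
        (\<lambda>H. \<Sum>i<k. matpow P i ** H ** matpow P (k - 1 - i))) (at P) \<and>
     (\<forall>\<pi> (N :: 'b measure) W.
        stationary_distribution P \<pi> \<and> limit_gaussian_matrix N W P \<pi> \<longrightarrow>
        (let W_Pk = (\<lambda>\<omega>. \<Sum>i<k. matpow P i ** W \<omega> ** matpow P (k - 1 - i));
             W_p = (\<lambda>\<omega>. vec_cols (transpose (W \<omega>)))
         in (\<forall>(M :: 'a measure) X. markov_chain M X P \<longrightarrow>
               converges_in_distribution M
                 (\<lambda>n \<omega>. sqrt (real n) *\<^sub>R (matpow (P_hat (\<lambda>m. X m \<omega>) n) k - matpow P k))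
                 N W_Pk) \<and>
            covariance_matrix N W_p = Sigma_p P \<pi> \<and>
            (\<forall>\<omega>. vec_cols (transpose (W_Pk \<omega>)) = M_mat P k *v W_p \<omega>) \<and>
            multivariate_normal N (\<lambda>\<omega>. vec_cols (transpose (W_Pk \<omega>))) 0
              (M_mat P k ** Sigma_p P \<pi> ** transpose (M_mat P k))))"
proof (intro conjI allI impI)
  show diff: "(\<lambda>B. matpow B k) differentiable (at A)" for A :: "real^'s^'s"
    using matpow_has_derivative[of k A] by (rule differentiableI)
  show deriv: "((\<lambda>B. matpow B k) has_derivative
        (\<lambda>H. \<Sum>i<k. matpow P i ** H ** matpow P (k - 1 - i))) (at P)"
    by (rule matpow_has_derivative)
  have meas: "(\<lambda>B :: real^'s^'s. matpow B k) \<in> borel_measurable borel"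
    by (intro borel_measurable_continuous_onI continuous_at_imp_continuous_on ballI
        differentiable_imp_continuous_within diff)
  fix \<pi> and N :: "'b measure" and W
  assume "stationary_distribution P \<pi> \<and> limit_gaussian_matrix N W P \<pi>"
  then have \<pi>: "stationary_distribution P \<pi>" and W: "limit_gaussian_matrix N W P \<pi>" by auto
  note vec = limit_gaussian_matrix_vec[OF W]
  have clt: "converges_in_distribution M
        (\<lambda>n \<omega>. sqrt (real n) *\<^sub>R (matpow (P_hat (\<lambda>m. X m \<omega>) n) k - matpow P k))
        N (\<lambda>\<omega>. \<Sum>i<k. matpow P i ** W \<omega> ** matpow P (k - 1 - i))"
    if "markov_chain M X P" for M :: "'a measure" and X
  proof -
    interpret irreducible_chain M X P \<pi>
      using that irreducible \<pi> by unfold_locales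
    show ?thesis by (rule differentiable_function_of_estimator_clt[OF W deriv meas])
  qed
  have "multivariate_normal N (\<lambda>\<omega>. M_mat P k *v vec_cols (transpose (W \<omega>))) 0
      (M_mat P k ** Sigma_p P \<pi> ** transpose (M_mat P k))"
    using multivariate_normal_linear_image[OF vec] by simp
  then show "let W_Pk = (\<lambda>\<omega>. \<Sum>i<k. matpow P i ** W \<omega> ** matpow P (k - 1 - i));
             W_p = (\<lambda>\<omega>. vec_cols (transpose (W \<omega>)))
         in (\<forall>(M :: 'a measure) X. markov_chain M X P \<longrightarrow>
               converges_in_distribution M
                 (\<lambda>n \<omega>. sqrt (real n) *\<^sub>R (matpow (P_hat (\<lambda>m. X m \<omega>) n) k - matpow P k))
                 N W_Pk) \<and>
            covariance_matrix N W_p = Sigma_p P \<pi> \<and>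
            (\<forall>\<omega>. vec_cols (transpose (W_Pk \<omega>)) = M_mat P k *v W_p \<omega>) \<and>
            multivariate_normal N (\<lambda>\<omega>. vec_cols (transpose (W_Pk \<omega>))) 0
              (M_mat P k ** Sigma_p P \<pi> ** transpose (M_mat P k))"
    using clt vec unfolding Let_def vec_cols_transpose_matpow_derivative multivariate_normal_def by blast
qed

end
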